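(* Let $X_1,X_2,\dots$ be real independent random variables with $E(X_j)=0$, $E(X_j^2)=1$ for all $j$, and $\sup_jE(|X_j|^3)<\infty$. For each $n\ge1$ let $\mathbf U^{(n)}=[u^{(n)}_{k,j}]$ be a random orthogonal matrix uniformly distributed on $O(n)$ and independent of $(X_j)$. Define $S_{n,k}=\sum_{j=1}^n u^{(n)}_{k,j}X_j$ for $k=1,\dots,n$. Then with probability one $$\sup_{x\in\mathbb R}\Big|\frac1n\sum_{k=1}^n1_{\{S_{n,k}\le x\}}-\frac1{\sqrt{2\pi}}\int_{-\infty}^x e^{-u^2/2}\,du\Big|\to0\quad\text{as } n\to\infty .$$
   Context: $O(n)$ is the group of real $n\times n$ orthogonal matrices, and "uniformly distributed" means distributed according to normalized Haar measure. All random variables and random matrices are defined on a common probability space. *)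

theory Defs
  imports "HOL-Probability.Probability" "Jordan_Normal_Form.Matrix"
begin

text \<open>Matrix entries, and accordingly the variables \<open>X\<close>, are indexed from 0.\<close>

definition orthogonal_group :: "nat \<Rightarrow> real mat set" where
  "orthogonal_group n =
    {Q \<in> carrier_mat n n. transpose_mat Q * Q = 1\<^sub>m n \<and> Q * transpose_mat Q = 1\<^sub>m n}"

text \<open>
  The type of matrices carries no topology.  Identifying an \<open>n\<close> by \<open>n\<close> matrix with its family of
  entries, the Borel sets of \<open>n\<close> by \<open>n\<close> matrices are the preimages of the sets of the product
  sigma-algebra.  Only \<open>space\<close> and \<open>sets\<close> of this and of the following measure are meaningful.
\<close>

definition borel_mat :: "nat \<Rightarrow> real mat measure" where
  "borel_mat n =
    vimage_algebra (carrier_mat n n)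
      (\<lambda>A. \<lambda>ij\<in>{..<n} \<times> {..<n}. A $$ ij)
      (\<Pi>\<^sub>M ij\<in>{..<n} \<times> {..<n}. borel)"

definition borel_orthogonal_group :: "nat \<Rightarrow> real mat measure" where
  "borel_orthogonal_group n = restrict_space (borel_mat n) (orthogonal_group n)"

text \<open>
  Normalized Haar measure is the unique Borel probability measure on the compact group
  \<open>O(n)\<close> that is invariant under left translations; right invariance is a consequence.
\<close>

definition normalized_haar_measure :: "nat \<Rightarrow> real mat measure \<Rightarrow> bool" where
  "normalized_haar_measure n \<mu> \<longleftrightarrow>
    prob_space \<mu> \<and>
    sets \<mu> = sets (borel_orthogonal_group n) \<and>
    (\<forall>Q\<in>orthogonal_group n. distr \<mu> \<mu> (\<lambda>A. Q * A) = \<mu>)"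

definition uniform_on_orthogonal_group :: "nat \<Rightarrow> 'a measure \<Rightarrow> ('a \<Rightarrow> real mat) \<Rightarrow> bool" where
  "uniform_on_orthogonal_group n M U \<longleftrightarrow>
    U \<in> measurable M (borel_orthogonal_group n) \<and>
    normalized_haar_measure n (distr M (borel_orthogonal_group n) U)"

text \<open>
  The library's \<open>indep_var\<close> requires both variables to have the same value type, which
  a matrix and a sequence of reals do not.  As in the usual definition, independence means
  independence of the generated sigma-algebras.
\<close>

definition independent_of_sequence ::
  "'a measure \<Rightarrow> 'b measure \<Rightarrow> ('a \<Rightarrow> 'b) \<Rightarrow> (nat \<Rightarrow> 'a \<Rightarrow> real) \<Rightarrow> bool" where
  "independent_of_sequence M N U X \<longleftrightarrow>
    prob_space.indep_set M
      (sets (vimage_algebra (space M) U N))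
      (sets (vimage_algebra (space M) (\<lambda>\<omega> j. X j \<omega>) (\<Pi>\<^sub>M j\<in>UNIV. borel)))"

end

theory Submission
  imports Defs "HOL-Real_Asymp.Real_Asymp"
begin

text \<open>
  Fix \<open>n\<close> and a vector \<open>x \<noteq> 0\<close>.  If \<open>U\<close> is Haar distributed, then \<open>U x\<close> is uniformly distributed
  on the sphere of radius \<open>\<bar>x\<bar>\<close>, and so is \<open>\<bar>x\<bar> G / \<bar>G\<bar>\<close> for a standard Gaussian vector \<open>G\<close>.
  Since \<open>U\<close> is independent of \<open>X\<close>, the vector \<open>S\<^sub>n\<close> behaves, conditionally on \<open>X\<close>, like a Gaussian
  vector that has been rescaled to the length of \<open>(X\<^sub>1, \<dots>, X\<^sub>n)\<close>.  The statement thus splits into two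
  facts that have nothing to do with each other: the empirical distribution of the coordinates of
  \<open>\<surd>n G / \<bar>G\<bar>\<close> is close to normal, and the length of \<open>(X\<^sub>1, \<dots>, X\<^sub>n)\<close> is asymptotically \<open>\<surd>n\<close>.

  The first fact has to come with summable error probabilities, because nothing is known about the
  joint distribution of the matrices for different \<open>n\<close>, and summability makes the Borel-Cantelli
  lemma apply whatever it is.  Hoeffding's inequality bounds the deviations of the empirical
  distribution function of \<open>G\<close> at a point exponentially, a Chernoff bound does the same for \<open>\<bar>G\<bar>\<^sup>2\<close>,
  and together they give \<open>gaussian_normalized_ecdf_summable_tail\<close>.

  The second fact is a strong law of large numbers for the squares \<open>X\<^sub>j\<^sup>2\<close>, which may have different
  distributions but have bounded moments of order \<open>3/2\<close> (\<open>AE_sum_squares_average\<close>).  Truncation and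
  Chebyshev's inequality give a deviation probability of order \<open>1 / \<surd>n\<close>.  This is summable along
  fourth powers, and the gaps are filled by monotonicity of the sums.

  The comparison of \<open>U x\<close> with \<open>G\<close> is an averaging argument.  For a scale-invariant function \<open>f\<close>
  the average of \<open>f (U\<^sup>T v)\<close> over the Haar measure does not depend on
  \<open>v \<noteq> 0\<close>, by left invariance and because reflections act transitively on spheres.  Integrating this
  average against any rotation-invariant law of \<open>v\<close> and exchanging the integrals shows that all such
  laws assign to \<open>f\<close> the same integral (\<open>nn_integral_rotation_invariant\<close>); the laws of \<open>U x\<close> and of
  \<open>G\<close> are two instances.  The rotation invariance of \<open>G\<close> reduces to that of Lebesgue measure, which
  is checked on reflections, since they generate the orthogonal group.

  Finally, the convergence of the empirical distribution functions at rational points, rescaled by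
  lengths that converge, is turned into convergence at every point and then into uniform
  convergence by monotonicity and continuity of the normal distribution function.
\<close>

section \<open>Vectors, orthogonal matrices and reflections\<close>

definition sqnorm :: "nat \<Rightarrow> (nat \<Rightarrow> real) \<Rightarrow> real" where
  "sqnorm n x = (\<Sum>i<n. (x i)\<^sup>2)"

text \<open>
  Vectors are functions on indices, extensional on \<open>{..<n}\<close>, so that they are the points of the
  product spaces \<open>PiM {..<n}\<close>.
\<close>

definition mat_apply :: "nat \<Rightarrow> real mat \<Rightarrow> (nat \<Rightarrow> real) \<Rightarrow> nat \<Rightarrow> real" where
  "mat_apply n A x = (\<lambda>i\<in>{..<n}. \<Sum>j<n. A $$ (i, j) * x j)"

text \<open>
  The Householder reflection in the hyperplane orthogonal to \<open>u\<close>.  As \<open>t / 0 = 0\<close>, it is the identity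
  for \<open>u = 0\<close>; so the lemmas below hold for every \<open>u\<close>.
\<close>

definition reflection :: "nat \<Rightarrow> (nat \<Rightarrow> real) \<Rightarrow> real mat" where
  "reflection n u = mat n n (\<lambda>(i, j). of_bool (i = j) - 2 * u i * u j / sqnorm n u)"

lemma sqnorm_nonneg: "0 \<le> sqnorm n x"
  by (simp add: sqnorm_def sum_nonneg)

lemma sqnorm_eq_0_iff: "sqnorm n x = 0 \<longleftrightarrow> (\<forall>i<n. x i = 0)"
  by (auto simp: sqnorm_def sum_nonneg_eq_0_iff)

lemma sqnorm_scale: "sqnorm n (\<lambda>i\<in>{..<n}. c * x i) = c\<^sup>2 * sqnorm n x"
  by (simp add: sqnorm_def power_mult_distrib sum_distrib_left)

lemma orthogonal_group_carrier: "Q \<in> orthogonal_group n \<Longrightarrow> Q \<in> carrier_mat n n"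
  by (simp add: orthogonal_group_def)

lemma orthogonal_group_transpose:
  "Q \<in> orthogonal_group n \<Longrightarrow> transpose_mat Q \<in> orthogonal_group n"
  by (auto simp: orthogonal_group_def)

lemma orthogonal_group_mult:
  assumes "P \<in> orthogonal_group n" "Q \<in> orthogonal_group n"
  shows "P * Q \<in> orthogonal_group n"
proof -
  note c = assms[THEN orthogonal_group_carrier]
  note t = transpose_carrier_mat[THEN iffD2, OF c(1)] transpose_carrier_mat[THEN iffD2, OF c(2)]
  have "transpose_mat (P * Q) * (P * Q) = transpose_mat Q * ((transpose_mat P * P) * Q)"
    using c t by (simp add: transpose_mult[OF c] assoc_mult_mat[of _ n n _ n _ n])
  also have "\<dots> = 1\<^sub>m n"
    using assms c by (simp add: orthogonal_group_def)
  finally have 1: "transpose_mat (P * Q) * (P * Q) = 1\<^sub>m n" .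
  have "(P * Q) * transpose_mat (P * Q) = P * ((Q * transpose_mat Q) * transpose_mat P)"
    using c t by (simp add: transpose_mult[OF c] assoc_mult_mat[of _ n n _ n _ n])
  also have "\<dots> = 1\<^sub>m n"
    using assms c by (simp add: orthogonal_group_def)
  finally show ?thesis
    using 1 c by (auto simp: orthogonal_group_def)
qed

lemma orthogonal_group_columns:
  assumes "Q \<in> orthogonal_group n" "j < n" "k < n"
  shows "(\<Sum>i<n. Q $$ (i, j) * Q $$ (i, k)) = of_bool (j = k)"
proof -
  have c: "Q \<in> carrier_mat n n" by (rule orthogonal_group_carrier) fact
  have "(transpose_mat Q * Q) $$ (j, k) = of_bool (j = k)"
    using assms by (simp add: orthogonal_group_def)
  then show ?thesis
    using c assms(2,3) by (simp add: scalar_prod_def atLeast0LessThan)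
qed

lemma mat_apply_one: "x \<in> extensional {..<n} \<Longrightarrow> mat_apply n (1\<^sub>m n) x = x"
  by (auto simp: mat_apply_def fun_eq_iff extensional_def if_distrib[of "\<lambda>t. t * _"] cong: if_cong)

lemma mat_apply_mult:
  assumes "A \<in> carrier_mat n n" "B \<in> carrier_mat n n"
  shows "mat_apply n (A * B) x = mat_apply n A (mat_apply n B x)"
proof -
  have "(\<Sum>j<n. (\<Sum>k<n. A $$ (i, k) * B $$ (k, j)) * x j)
      = (\<Sum>k<n. A $$ (i, k) * (\<Sum>j<n. B $$ (k, j) * x j))" for i
    by (simp add: sum_distrib_left sum_distrib_right mult.assoc) (rule sum.swap)
  then show ?thesis
    using assms by (auto simp: mat_apply_def fun_eq_iff scalar_prod_def atLeast0LessThan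
        intro!: sum.cong)
qed

lemma sqnorm_mat_apply:
  assumes "Q \<in> orthogonal_group n"
  shows "sqnorm n (mat_apply n Q x) = sqnorm n x"
proof -
  have "sqnorm n (mat_apply n Q x) = (\<Sum>i<n. \<Sum>j<n. \<Sum>k<n. (x j * x k) * (Q $$ (i, j) * Q $$ (i, k)))"
    unfolding sqnorm_def
    by (intro sum.cong) (auto simp: mat_apply_def power2_eq_square sum_product mult_ac intro!: sum.cong)
  also have "\<dots> = (\<Sum>j<n. \<Sum>i<n. \<Sum>k<n. (x j * x k) * (Q $$ (i, j) * Q $$ (i, k)))"
    by (rule sum.swap)
  also have "\<dots> = (\<Sum>j<n. \<Sum>k<n. \<Sum>i<n. (x j * x k) * (Q $$ (i, j) * Q $$ (i, k)))"
    by (rule sum.cong[OF refl]) (rule sum.swap)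
  also have "\<dots> = (\<Sum>j<n. \<Sum>k<n. (x j * x k) * of_bool (j = k))"
    using assms by (simp add: orthogonal_group_columns flip: sum_distrib_left)
  also have "\<dots> = sqnorm n x"
    by (simp add: sqnorm_def power2_eq_square of_bool_def if_distrib[of "\<lambda>t. _ * t"] cong: if_cong)
  finally show ?thesis .
qed

lemma reflection_carrier [simp]: "reflection n u \<in> carrier_mat n n"
  by (simp add: reflection_def)

lemma mat_apply_reflection:
  "mat_apply n (reflection n u) x =
    (\<lambda>i\<in>{..<n}. x i - 2 * (\<Sum>j<n. u j * x j) / sqnorm n u * u i)"
proof -
  have "(\<Sum>j<n. reflection n u $$ (i, j) * x j) = x i - 2 * (\<Sum>j<n. u j * x j) / sqnorm n u * u i"
    if "i < n" for i
  proof -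
    have "(\<Sum>j<n. reflection n u $$ (i, j) * x j)
        = (\<Sum>j<n. (if i = j then x j else 0) - (2 * u i / sqnorm n u) * (u j * x j))"
      using that by (intro sum.cong) (auto simp: reflection_def algebra_simps)
    also have "\<dots> = x i - (2 * u i / sqnorm n u) * (\<Sum>j<n. u j * x j)"
      using that by (simp add: sum_subtractf sum_distrib_left)
    finally show ?thesis by simp
  qed
  then show ?thesis by (auto simp: mat_apply_def fun_eq_iff)
qed

lemma mat_eqI_apply:
  assumes "A \<in> carrier_mat n n" "B \<in> carrier_mat n n"
    and "\<And>x. x \<in> extensional {..<n} \<Longrightarrow> mat_apply n A x = mat_apply n B x"
  shows "A = B"
proof (rule eq_matI)
  fix i k assume "i < dim_row B" "k < dim_col B"
  then have ik: "i < n" "k < n" using assms by auto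
  have "mat_apply n A (\<lambda>j\<in>{..<n}. of_bool (j = k)) i = mat_apply n B (\<lambda>j\<in>{..<n}. of_bool (j = k)) i"
    using assms(3) by simp
  then show "A $$ (i, k) = B $$ (i, k)"
    using ik by (simp add: mat_apply_def of_bool_def if_distrib[of "\<lambda>t. _ * t"] cong: if_cong)
qed (use assms in auto)

lemma reflection_symmetric: "transpose_mat (reflection n u) = reflection n u"
  by (auto simp: reflection_def intro!: eq_matI)

lemma reflection_involution: "reflection n u * reflection n u = 1\<^sub>m n"
proof (rule mat_eqI_apply[of _ n])
  fix x :: "nat \<Rightarrow> real" assume x: "x \<in> extensional {..<n}"
  let ?s = "sqnorm n u" and ?a = "\<Sum>j<n. u j * x j"
  have "(\<Sum>j<n. u j * (x j - c * u j)) = ?a - c * ?s" for c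
    unfolding sqnorm_def right_diff_distrib sum_subtractf
    by (simp add: power2_eq_square mult.left_commute flip: sum_distrib_left)
  from this[of "2 * ?a / ?s"]
  have *: "2 * (\<Sum>j<n. u j * (x j - 2 * ?a / ?s * u j)) / ?s = - 2 * ?a / ?s"
    by (cases "?s = 0") auto
  show "mat_apply n (reflection n u * reflection n u) x = mat_apply n (1\<^sub>m n) x"
    using x * by (auto simp: mat_apply_mult[of _ n] mat_apply_one mat_apply_reflection fun_eq_iff
        extensional_def)
qed (auto intro: mult_carrier_mat[of _ n n])

lemma reflection_orthogonal: "reflection n u \<in> orthogonal_group n"
  by (simp add: orthogonal_group_def reflection_symmetric reflection_involution)

text \<open>
  The hyperplane orthogonal to \<open>v - w\<close> bisects the angle between the equally long vectors \<open>v\<close> and \<open>w\<close>.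
  So the orthogonal group acts transitively on spheres.
\<close>

lemma reflection_swaps:
  assumes "sqnorm n v = sqnorm n w" "w \<in> extensional {..<n}"
  shows "mat_apply n (reflection n (\<lambda>i. v i - w i)) v = w"
proof (cases "sqnorm n (\<lambda>i. v i - w i) = 0")
  case True
  then have "\<forall>i<n. v i = w i" by (simp add: sqnorm_eq_0_iff)
  then show ?thesis
    using True assms(2) by (auto simp: mat_apply_reflection fun_eq_iff extensional_def)
next
  case False
  have "sqnorm n (\<lambda>i. v i - w i) = sqnorm n v + sqnorm n w - 2 * (\<Sum>j<n. v j * w j)"
    by (simp add: sqnorm_def power2_diff sum_subtractf sum.distrib sum_distrib_left mult.assoc)
  also have "\<dots> = 2 * (\<Sum>j<n. (v j - w j) * v j)"
    using assms(1) by (simp add: sqnorm_def left_diff_distrib sum_subtractf power2_eq_square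
        mult.commute[of "w _" "v _"])
  finally show ?thesis
    using False assms(2) by (auto simp: mat_apply_reflection fun_eq_iff extensional_def)
qed

text \<open>
  Reflections generate the orthogonal group: composing \<open>Q\<close> with the reflection that takes the column
  \<open>Q e\<^sub>m\<close> to \<open>e\<^sub>m\<close> makes \<open>e\<^sub>m\<close> a fixed vector.  Basis vectors \<open>e\<^sub>j\<close> that were already fixed stay fixed,
  because they are orthogonal to both \<open>Q e\<^sub>m\<close> and \<open>e\<^sub>m\<close>.
\<close>

lemma orthogonal_group_reflection_induct [consumes 1, case_names one reflection]:
  assumes Q: "Q \<in> orthogonal_group n"
    and one: "P (1\<^sub>m n)"
    and step: "\<And>u A. A \<in> orthogonal_group n \<Longrightarrow> P A \<Longrightarrow> P (reflection n u * A)"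
  shows "P Q"
proof -
  \<comment> \<open>Induction on the number \<open>m\<close> of leading basis vectors that need not be fixed.\<close>
  have "P Q" if "Q \<in> orthogonal_group n"
    "\<And>i j. i < n \<Longrightarrow> j < n \<Longrightarrow> m \<le> j \<Longrightarrow> Q $$ (i, j) = of_bool (i = j)" for Q m
    using that
  proof (induction m arbitrary: Q)
    case 0
    then have "Q = 1\<^sub>m n"
      by (intro eq_matI) (auto dest: orthogonal_group_carrier)
    with one show ?case by simp
  next
    case (Suc m)
    note Q = Suc.prems(1)
    note Qc = Q[THEN orthogonal_group_carrier]
    show ?case
    proof (cases "m < n")
      case False
      with Suc show ?thesis by auto
    next
      case m: True
      define v where "v j = (\<lambda>i\<in>{..<n}. Q $$ (i, j))" for j
      define e :: "nat \<Rightarrow> nat \<Rightarrow> real" where "e j = (\<lambda>i\<in>{..<n}. of_bool (i = j))" for j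
      define u where "u = (\<lambda>i. v m i - e m i)"
      let ?A = "reflection n u * Q"
      have col: "mat_apply n B (e j) = (\<lambda>i\<in>{..<n}. B $$ (i, j))" if "j < n" for B j
        using that by (auto simp: mat_apply_def e_def fun_eq_iff of_bool_def
            if_distrib[of "\<lambda>t. _ * t"] cong: if_cong)
      have vj: "v j = mat_apply n Q (e j)" if "j < n" for j
        using that by (simp add: col v_def)
      have "sqnorm n (v m) = sqnorm n (e m)"
        using vj[OF m] Q by (simp add: sqnorm_mat_apply)
      then have um: "mat_apply n (reflection n u) (v m) = e m"
        unfolding u_def by (rule reflection_swaps) (simp add: e_def)
      have uj: "mat_apply n (reflection n u) (v j) = e j" if j: "m < j" "j < n" for j
      proof -
        have vje: "v j = e j"
          using Suc.prems(2)[of _ j] j by (auto simp: v_def e_def fun_eq_iff)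
        \<comment> \<open>\<open>e\<^sub>j\<close> is orthogonal to the normal vector \<open>u\<close> of the reflection.\<close>
        have "(\<Sum>i<n. u i * v j i) = (\<Sum>i<n. Q $$ (i, m) * Q $$ (i, j)) - (\<Sum>i<n. e m i * e j i)"
          by (simp add: vje u_def left_diff_distrib sum_subtractf)
             (simp add: v_def flip: vje)
        also have "\<dots> = 0"
          using orthogonal_group_columns[OF Q m j(2)] j m
          by (auto simp: e_def of_bool_def intro!: sum.neutral)
        finally show ?thesis
          unfolding mat_apply_reflection vje by (auto simp: e_def fun_eq_iff)
      qed
      have "?A $$ (i, j) = of_bool (i = j)" if "i < n" "j < n" "m \<le> j" for i j
      proof -
        have "mat_apply n ?A (e j) i = e j i"
          using um uj[of j] that by (cases "m = j") (auto simp: mat_apply_mult[OF reflection_carrier Qc] vj)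
        then show ?thesis using that by (simp only: col) (simp add: e_def)
      qed
      then have PA: "P ?A"
        using Suc.IH[of ?A] orthogonal_group_mult[OF reflection_orthogonal Q] by blast
      have "reflection n u * ?A = (reflection n u * reflection n u) * Q"
        using Qc by (subst assoc_mult_mat[of _ n n _ n _ n]) auto
      also have "\<dots> = Q"
        using Qc by (simp add: reflection_involution)
      finally show ?thesis
        using step[of ?A u] PA orthogonal_group_mult[OF reflection_orthogonal Q] by simp
    qed
  qed
  from this[of Q n] Q show ?thesis by simp
qed

section \<open>Rotation invariance of Lebesgue and Gaussian measure\<close>

lemma nn_integral_PiM_lborel_translate:
  fixes f :: "('i \<Rightarrow> real) \<Rightarrow> ennreal"
  assumes J: "finite J" and f: "f \<in> borel_measurable (PiM J (\<lambda>_. borel))"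
  shows "(\<integral>\<^sup>+x. f (\<lambda>j\<in>J. x j + b j) \<partial>PiM J (\<lambda>_. lborel)) = integral\<^sup>N (PiM J (\<lambda>_. lborel)) f"
proof -
  interpret product_sigma_finite "\<lambda>_::'i. lborel :: real measure" by standard
  let ?L = "PiM J (\<lambda>_. lborel) :: ('i \<Rightarrow> real) measure"
  let ?t = "\<lambda>x. \<lambda>j\<in>J. x j + b j"
  have [measurable]: "?t \<in> measurable ?L ?L"
    by (intro measurable_restrict) measurable
  have "distr ?L ?L ?t = ?L"
  proof (rule PiM_eqI[OF J])
    fix A :: "'i \<Rightarrow> real set" assume A: "\<And>i. i \<in> J \<Longrightarrow> A i \<in> sets lborel"
    have "?t -` Pi\<^sub>E J A \<inter> space ?L = Pi\<^sub>E J (\<lambda>j. (\<lambda>y. y + b j) -` A j)"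
      by (auto simp: space_PiM PiE_iff extensional_def)
    moreover have "emeasure ?L (Pi\<^sub>E J (\<lambda>j. (\<lambda>y. y + b j) -` A j))
        = (\<Prod>j\<in>J. emeasure lborel ((\<lambda>y. y + b j) -` A j))"
      using A measurable_sets_borel[of "\<lambda>y. y + b _" borel]
      by (intro emeasure_PiM J) auto
    moreover have "emeasure lborel ((\<lambda>y. y + b j) -` A j) = emeasure lborel (A j)" if "j \<in> J" for j
    proof -
      have "emeasure lborel (A j) = emeasure (distr lborel borel (\<lambda>y. b j + y)) (A j)"
        by (simp only: lborel_distr_plus)
      also have "\<dots> = emeasure lborel ((\<lambda>y. b j + y) -` A j)"
        using A[OF that] by (subst emeasure_distr) auto
      finally show ?thesis by (simp add: add.commute)
    qed
    ultimately show "emeasure (distr ?L ?L ?t) (Pi\<^sub>E J A) = (\<Prod>i\<in>J. emeasure lborel (A i))"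
      using A J by (subst emeasure_distr) (auto intro!: sets_PiM_I_finite)
  qed simp
  moreover have "f \<in> borel_measurable ?L"
    using f by (simp cong: measurable_cong_sets add: sets_PiM_cong[of J J "\<lambda>_. lborel" "\<lambda>_. borel"])
  ultimately show ?thesis
    using nn_integral_distr[of ?t ?L ?L f] by simp
qed

lemma borel_measurable_PiM_lborel:
  "f \<in> borel_measurable (PiM J (\<lambda>_. borel)) \<longleftrightarrow> f \<in> borel_measurable (PiM J (\<lambda>_. lborel))"
  by (rule arg_cong[where f = "\<lambda>S. f \<in> S"], intro measurable_cong_sets sets_PiM_cong) auto

lemma measurable_sqnorm [measurable]:
  "sqnorm n \<in> borel_measurable (PiM {..<n} (\<lambda>_. borel))"
  "sqnorm n \<in> borel_measurable (PiM {..<n} (\<lambda>_. lborel))"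
  unfolding sqnorm_def by measurable

lemma nn_integral_lborel_reflect:
  assumes [measurable]: "f \<in> borel_measurable borel"
  shows "(\<integral>\<^sup>+t. f (c - t :: real) \<partial>lborel) = integral\<^sup>N lborel f"
  using nn_integral_real_affine[OF assms, of "-1" c] by simp

lemma measurable_mat_apply [measurable]:
  "mat_apply n A \<in> measurable (PiM {..<n} (\<lambda>_. borel)) (PiM {..<n} (\<lambda>_. borel))"
  unfolding mat_apply_def by measurable

text \<open>
  If \<open>u i \<noteq> 0\<close>, the reflection in \<open>u\<close> is the composition of a shear
  that adds multiples of the coordinate \<open>i\<close> to the others, of the map \<open>t \<mapsto> c - t\<close> in the coordinate
  \<open>i\<close>, where \<open>c\<close> depends on the other coordinates, and of another such shear.  By Fubini's theorem
  each factor preserves the product measure because one-dimensional Lebesgue measure is invariant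
  under translations and \<open>t \<mapsto> -t\<close>.
\<close>

lemma nn_integral_reflection:
  fixes f :: "(nat \<Rightarrow> real) \<Rightarrow> ennreal"
  assumes f: "f \<in> borel_measurable (PiM {..<n} (\<lambda>_. borel))"
  shows "(\<integral>\<^sup>+x. f (mat_apply n (reflection n u) x) \<partial>PiM {..<n} (\<lambda>_. lborel))
       = integral\<^sup>N (PiM {..<n} (\<lambda>_. lborel)) f"
proof (cases "\<forall>i<n. u i = 0")
  case True
  then have "sqnorm n u = 0" by (simp add: sqnorm_eq_0_iff)
  then show ?thesis
    by (intro nn_integral_cong arg_cong[where f = f])
       (auto simp: mat_apply_reflection space_PiM PiE_iff extensional_def fun_eq_iff)
next
  case False
  then obtain i where i: "i < n" "u i \<noteq> 0" by auto
  let ?s = "sqnorm n u"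
  have s: "?s \<noteq> 0" using i by (auto simp: sqnorm_eq_0_iff)
  define J where "J = {..<n} - {i}"
  have J: "finite J" "i \<notin> J" and ins: "{..<n} = insert i J"
    using i by (auto simp: J_def)
  interpret product_sigma_finite "\<lambda>_::nat. lborel :: real measure" by standard
  interpret PJ: finite_product_sigma_finite "\<lambda>_::nat. lborel :: real measure" J
    by standard (rule J)
  interpret P: pair_sigma_finite "PiM J (\<lambda>_. lborel :: real measure)" "lborel :: real measure"
    by (intro pair_sigma_finite.intro PJ.sigma_finite_measure_axioms sigma_finite_lborel)
  note f' [measurable] = f[unfolded ins]
  let ?R = "mat_apply n (reflection n u)"
  note R' [measurable] = measurable_mat_apply[of n "reflection n u", unfolded ins]
  define c where "c j = u j / u i" for j
  define a where "a x = (\<Sum>j\<in>J. u j * x j)" for x :: "nat \<Rightarrow> real"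
  \<comment> \<open>\<open>h x\<close> is \<open>f\<close> along the line with direction \<open>u\<close> through \<open>x\<close>, parametrized by the coordinate \<open>i\<close>;
    the reflection maps this line to itself.\<close>
  define h where "h x t = f ((\<lambda>j\<in>J. x j + c j * t)(i := t))" for x :: "nat \<Rightarrow> real" and t :: real
  have h [measurable]: "case_prod h \<in> borel_measurable (PiM J (\<lambda>_. lborel) \<Otimes>\<^sub>M lborel)"
    unfolding h_def case_prod_beta by measurable
  have h' [measurable]: "h x \<in> borel_measurable borel" if "x \<in> space (PiM J (\<lambda>_. lborel))" for x
    using measurable_Pair2[OF h that] by simp
  have a [measurable]: "a \<in> borel_measurable (PiM J (\<lambda>_. lborel))"
    unfolding a_def by measurable
  have shear: "(\<integral>\<^sup>+t. \<integral>\<^sup>+x. g (x(i := t)) \<partial>PiM J (\<lambda>_. lborel) \<partial>lborel)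
      = (\<integral>\<^sup>+t. \<integral>\<^sup>+x. g ((\<lambda>j\<in>J. x j + c j * t)(i := t)) \<partial>PiM J (\<lambda>_. lborel) \<partial>lborel)"
    if [measurable]: "g \<in> borel_measurable (PiM (insert i J) (\<lambda>_. borel))" for g :: "_ \<Rightarrow> ennreal"
    by (intro nn_integral_cong nn_integral_PiM_lborel_translate[symmetric] J) measurable
  have reflect: "?R ((\<lambda>j\<in>J. x j + c j * t)(i := t)) = (\<lambda>j\<in>J. x j + c j * t')(i := t')"
    if t': "t' = - (2 * u i * a x / ?s) - t" for x t t'
  proof -
    let ?y = "(\<lambda>j\<in>J. x j + c j * t)(i := t)"
    have "(\<Sum>j<n. u j * ?y j) = u i * t + (\<Sum>j\<in>J. u j * (x j + c j * t))"
      using J by (auto simp: ins intro!: sum.cong)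
    also have "(\<Sum>j\<in>J. u j * (x j + c j * t)) = a x + (t / u i) * (\<Sum>j\<in>J. (u j)\<^sup>2)"
      by (simp add: a_def c_def distrib_left sum.distrib sum_distrib_left power2_eq_square mult_ac)
    also have "u i * t + \<dots> = a x + (t / u i) * ((u i)\<^sup>2 + (\<Sum>j\<in>J. (u j)\<^sup>2))"
      using i by (simp add: field_simps power2_eq_square)
    also have "(u i)\<^sup>2 + (\<Sum>j\<in>J. (u j)\<^sup>2) = ?s"
      using J by (simp add: sqnorm_def ins)
    finally have coeff: "2 * (\<Sum>j<n. u j * ?y j) / ?s = 2 * a x / ?s + 2 * (t / u i)"
      using s by (simp only: add_divide_distrib distrib_left) simp
    show ?thesis
      using i J(2) unfolding mat_apply_reflection coeff t'
      by (auto simp: fun_eq_iff ins c_def field_simps)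
  qed
  have "(\<integral>\<^sup>+x. f (?R x) \<partial>PiM {..<n} (\<lambda>_. lborel))
      = (\<integral>\<^sup>+t. \<integral>\<^sup>+x. f (?R (x(i := t))) \<partial>PiM J (\<lambda>_. lborel) \<partial>lborel)"
    unfolding ins using J by (intro product_nn_integral_insert_rev) (simp_all flip: borel_measurable_PiM_lborel)
  also have "\<dots> = (\<integral>\<^sup>+t. \<integral>\<^sup>+x. h x (- (2 * u i * a x / ?s) - t) \<partial>PiM J (\<lambda>_. lborel) \<partial>lborel)"
    by (subst shear) (simp_all add: reflect h_def)
  also have "\<dots> = (\<integral>\<^sup>+x. \<integral>\<^sup>+t. h x (- (2 * u i * a x / ?s) - t) \<partial>lborel \<partial>PiM J (\<lambda>_. lborel))"
    by (intro P.Fubini') measurable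
  also have "\<dots> = (\<integral>\<^sup>+x. \<integral>\<^sup>+t. h x t \<partial>lborel \<partial>PiM J (\<lambda>_. lborel))"
    by (intro nn_integral_cong nn_integral_lborel_reflect) simp
  also have "\<dots> = (\<integral>\<^sup>+t. \<integral>\<^sup>+x. h x t \<partial>PiM J (\<lambda>_. lborel) \<partial>lborel)"
    by (intro P.Fubini'[symmetric]) measurable
  also have "\<dots> = (\<integral>\<^sup>+t. \<integral>\<^sup>+x. f (x(i := t)) \<partial>PiM J (\<lambda>_. lborel) \<partial>lborel)"
    unfolding h_def by (rule shear[symmetric]) measurable
  also have "\<dots> = integral\<^sup>N (PiM {..<n} (\<lambda>_. lborel)) f"
    unfolding ins using J
    by (intro product_nn_integral_insert_rev[symmetric]) (simp_all flip: borel_measurable_PiM_lborel)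
  finally show ?thesis .
qed

lemma nn_integral_orthogonal:
  fixes f :: "(nat \<Rightarrow> real) \<Rightarrow> ennreal"
  assumes "Q \<in> orthogonal_group n" and f: "f \<in> borel_measurable (PiM {..<n} (\<lambda>_. borel))"
  shows "(\<integral>\<^sup>+x. f (mat_apply n Q x) \<partial>PiM {..<n} (\<lambda>_. lborel))
       = integral\<^sup>N (PiM {..<n} (\<lambda>_. lborel)) f"
  using assms
proof (induction arbitrary: f rule: orthogonal_group_reflection_induct)
  case one
  show ?case
    by (intro nn_integral_cong) (simp add: mat_apply_one space_PiM PiE_def)
next
  case (reflection u A)
  note [measurable] = reflection.prems
  have "(\<integral>\<^sup>+x. f (mat_apply n (reflection n u) (mat_apply n A x)) \<partial>PiM {..<n} (\<lambda>_. lborel))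
      = (\<integral>\<^sup>+x. f (mat_apply n (reflection n u) x) \<partial>PiM {..<n} (\<lambda>_. lborel))"
    by (rule reflection.IH) measurable
  then show ?case
    using reflection by (simp add: mat_apply_mult orthogonal_group_carrier nn_integral_reflection)
qed

abbreviation gaussian :: "nat \<Rightarrow> (nat \<Rightarrow> real) measure" where
  "gaussian n \<equiv> PiM {..<n} (\<lambda>_. std_normal_distribution)"

lemma prob_space_std_normal: "prob_space std_normal_distribution"
  by (rule prob_space_normal_density) simp

lemma prob_space_gaussian: "prob_space (gaussian n)"
  by (intro prob_space_PiM prob_space_std_normal)

lemma sets_gaussian [measurable_cong]: "sets (gaussian n) = sets (PiM {..<n} (\<lambda>_. borel))"
  by (intro sets_PiM_cong) auto

text \<open>
  The density depends on the length of the vector only, which is why rotation invariance is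
  inherited from Lebesgue measure.
\<close>

lemma gaussian_eq_density:
  "gaussian n = density (PiM {..<n} (\<lambda>_. lborel))
     (\<lambda>x. ennreal ((1 / sqrt (2 * pi)) ^ n * exp (- sqnorm n x / 2)))"
proof -
  interpret N: product_sigma_finite "\<lambda>_::nat. std_normal_distribution"
    using prob_space_std_normal by (intro product_sigma_finite.intro prob_space_imp_sigma_finite)
  interpret L: product_sigma_finite "\<lambda>_::nat. lborel :: real measure" by standard
  let ?d = "\<lambda>x. ennreal ((1 / sqrt (2 * pi)) ^ n * exp (- sqnorm n x / 2))"
  have d: "?d x = (\<Prod>i<n. ennreal (std_normal_density (x i)))" for x
  proof -
    have "(\<Prod>i<n. std_normal_density (x i))
        = (1 / sqrt (2 * pi)) ^ n * (\<Prod>i<n. exp (- (x i)\<^sup>2 / 2))"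
      unfolding std_normal_density_def prod.distrib prod_constant card_lessThan by (rule refl)
    also have "(\<Prod>i<n. exp (- (x i)\<^sup>2 / 2)) = exp (\<Sum>i<n. - (x i)\<^sup>2 / 2)"
      by (rule exp_sum[symmetric]) simp
    also have "(\<Sum>i<n. - (x i)\<^sup>2 / 2) = - sqnorm n x / 2"
      unfolding sqnorm_def sum_divide_distrib[symmetric] sum_negf by (rule refl)
    finally have "(\<Prod>i<n. std_normal_density (x i)) = (1 / sqrt (2 * pi)) ^ n * exp (- sqnorm n x / 2)" .
    moreover have "(\<Prod>i<n. ennreal (std_normal_density (x i)))
        = ennreal (\<Prod>i<n. std_normal_density (x i))"
      by (rule prod_ennreal) simp
    ultimately show ?thesis by (simp only:)
  qed
  show ?thesis
  proof (rule N.PiM_eqI[symmetric])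
    show "sets (density (PiM {..<n} (\<lambda>_. lborel)) ?d) = sets (gaussian n)"
      unfolding sets_density by (intro sets_PiM_cong) auto
    fix A :: "nat \<Rightarrow> real set" assume A: "\<And>i. i \<in> {..<n} \<Longrightarrow> A i \<in> sets std_normal_distribution"
    have "emeasure (density (PiM {..<n} (\<lambda>_. lborel)) ?d) (Pi\<^sub>E {..<n} A)
        = (\<integral>\<^sup>+x. ?d x * indicator (Pi\<^sub>E {..<n} A) x \<partial>PiM {..<n} (\<lambda>_. lborel))"
      using A by (intro emeasure_density) (auto intro!: sets_PiM_I_finite)
    also have "\<dots> = (\<integral>\<^sup>+x. (\<Prod>i<n. ennreal (std_normal_density (x i)) * indicator (A i) (x i))
        \<partial>PiM {..<n} (\<lambda>_. lborel))"
    proof (intro nn_integral_cong)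
      fix x assume x: "x \<in> space (PiM {..<n} (\<lambda>_. lborel :: real measure))"
      then have "indicator (Pi\<^sub>E {..<n} A) x = (\<Prod>i<n. indicator (A i) (x i) :: ennreal)"
        by (cases "\<forall>i<n. x i \<in> A i")
           (auto simp: space_PiM PiE_iff prod_zero_iff indicator_def)
      then show "?d x * indicator (Pi\<^sub>E {..<n} A) x
          = (\<Prod>i<n. ennreal (std_normal_density (x i)) * indicator (A i) (x i))"
        by (simp only: d prod.distrib)
    qed
    also have "\<dots> = (\<Prod>i<n. \<integral>\<^sup>+x. ennreal (std_normal_density x) * indicator (A i) x \<partial>lborel)"
      using A by (intro L.product_nn_integral_prod) auto
    also have "\<dots> = (\<Prod>i<n. emeasure std_normal_distribution (A i))"
      using A by (intro prod.cong) (auto simp: emeasure_density)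
    finally show "emeasure (density (PiM {..<n} (\<lambda>_. lborel)) ?d) (Pi\<^sub>E {..<n} A)
        = (\<Prod>i<n. emeasure std_normal_distribution (A i))" .
  qed simp
qed

lemma nn_integral_gaussian_orthogonal:
  fixes f :: "(nat \<Rightarrow> real) \<Rightarrow> ennreal"
  assumes Q: "Q \<in> orthogonal_group n"
    and f [measurable]: "f \<in> borel_measurable (PiM {..<n} (\<lambda>_. borel))"
  shows "(\<integral>\<^sup>+x. f (mat_apply n Q x) \<partial>gaussian n) = integral\<^sup>N (gaussian n) f"
proof -
  let ?d = "\<lambda>x. ennreal ((1 / sqrt (2 * pi)) ^ n * exp (- sqnorm n x / 2))"
  note [measurable] = f[unfolded borel_measurable_PiM_lborel]
  have "(\<lambda>x. f (mat_apply n Q x)) \<in> borel_measurable (PiM {..<n} (\<lambda>_. borel))"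
    by measurable
  note [measurable] = this[unfolded borel_measurable_PiM_lborel]
  have "(\<integral>\<^sup>+x. f (mat_apply n Q x) \<partial>gaussian n)
      = (\<integral>\<^sup>+x. ?d (mat_apply n Q x) * f (mat_apply n Q x) \<partial>PiM {..<n} (\<lambda>_. lborel))"
    using Q unfolding gaussian_eq_density by (subst nn_integral_density) (simp_all add: sqnorm_mat_apply)
  also have "\<dots> = (\<integral>\<^sup>+x. ?d x * f x \<partial>PiM {..<n} (\<lambda>_. lborel))"
    using Q by (intro nn_integral_orthogonal) measurable
  also have "\<dots> = integral\<^sup>N (gaussian n) f"
    unfolding gaussian_eq_density by (subst nn_integral_density) simp_all
  finally show ?thesis .
qed

section \<open>The image of a vector under a Haar distributed matrix\<close>

lemma space_borel_orthogonal_group [simp]: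
  "space (borel_orthogonal_group n) = orthogonal_group n"
  by (auto simp: borel_orthogonal_group_def borel_mat_def space_restrict_space
      dest: orthogonal_group_carrier)

lemma measurable_matrix_entry:
  assumes "i < n" "j < n"
  shows "(\<lambda>A. A $$ (i, j)) \<in> borel_measurable (borel_orthogonal_group n)"
proof -
  let ?e = "\<lambda>A::real mat. \<lambda>ij\<in>{..<n} \<times> {..<n}. A $$ ij"
  have "?e \<in> measurable (borel_mat n) (\<Pi>\<^sub>M ij\<in>{..<n} \<times> {..<n}. borel)"
    unfolding borel_mat_def by (rule measurable_vimage_algebra1) (auto simp: space_PiM)
  from measurable_compose[OF this measurable_component_singleton[of "(i, j)"]] assms
  have "(\<lambda>A. A $$ (i, j)) \<in> borel_measurable (borel_mat n)"
    by simp
  then show ?thesis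
    unfolding borel_orthogonal_group_def by (rule measurable_restrict_space1)
qed

lemma measurable_borel_orthogonal_groupI:
  assumes "\<And>w. w \<in> space N \<Longrightarrow> g w \<in> orthogonal_group n"
    and "\<And>i j. i < n \<Longrightarrow> j < n \<Longrightarrow> (\<lambda>w. g w $$ (i, j)) \<in> borel_measurable N"
  shows "g \<in> measurable N (borel_orthogonal_group n)"
  unfolding borel_orthogonal_group_def borel_mat_def
  using assms
  by (intro measurable_restrict_space2 measurable_vimage_algebra2 measurable_restrict)
     (auto dest: orthogonal_group_carrier)

lemma measurable_mult_orthogonal:
  assumes Q: "Q \<in> orthogonal_group n"
  shows "(\<lambda>A. Q * A) \<in> measurable (borel_orthogonal_group n) (borel_orthogonal_group n)"
proof (rule measurable_borel_orthogonal_groupI)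
  fix i j assume ij: "i < n" "j < n"
  have "(\<lambda>A. \<Sum>k<n. Q $$ (i, k) * A $$ (k, j)) \<in> borel_measurable (borel_orthogonal_group n)"
    using ij by (intro borel_measurable_sum borel_measurable_times measurable_matrix_entry) auto
  moreover have *: "(Q * A) $$ (i, j) = (\<Sum>k<n. Q $$ (i, k) * A $$ (k, j))"
    if "A \<in> orthogonal_group n" for A
    using ij Q[THEN orthogonal_group_carrier] that[THEN orthogonal_group_carrier]
    by (simp add: scalar_prod_def atLeast0LessThan)
  ultimately show "(\<lambda>A. (Q * A) $$ (i, j)) \<in> borel_measurable (borel_orthogonal_group n)"
    by (subst measurable_cong[OF *]) simp_all
qed (use Q in \<open>simp add: orthogonal_group_mult\<close>)

lemma measurable_mat_apply_pair:
  "(\<lambda>(A, x). mat_apply n A x)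
    \<in> measurable (borel_orthogonal_group n \<Otimes>\<^sub>M PiM {..<n} (\<lambda>_. borel)) (PiM {..<n} (\<lambda>_. borel))"
proof -
  have "(\<lambda>p. fst p $$ (i, j)) \<in> borel_measurable (borel_orthogonal_group n \<Otimes>\<^sub>M PiM {..<n} (\<lambda>_. borel))"
    if "i < n" "j < n" for i j
    using measurable_compose[OF measurable_fst measurable_matrix_entry[OF that]] .
  then show ?thesis
    unfolding mat_apply_def case_prod_beta
    by (intro measurable_restrict borel_measurable_sum borel_measurable_times)
       (auto intro: measurable_compose[OF measurable_snd measurable_component_singleton])
qed

lemma measurable_mat_apply_transpose_pair:
  "(\<lambda>(A, x). mat_apply n (transpose_mat A) x)
    \<in> measurable (borel_orthogonal_group n \<Otimes>\<^sub>M PiM {..<n} (\<lambda>_. borel)) (PiM {..<n} (\<lambda>_. borel))"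
proof -
  have "transpose_mat \<in> measurable (borel_orthogonal_group n) (borel_orthogonal_group n)"
  proof (rule measurable_borel_orthogonal_groupI)
    fix i j assume "i < n" "j < n"
    then have "(\<lambda>A. A $$ (j, i)) \<in> borel_measurable (borel_orthogonal_group n)"
      by (intro measurable_matrix_entry)
    moreover have *: "transpose_mat A $$ (i, j) = A $$ (j, i)" if "A \<in> orthogonal_group n" for A
      using that[THEN orthogonal_group_carrier] \<open>i < n\<close> \<open>j < n\<close> by simp
    ultimately show "(\<lambda>A. transpose_mat A $$ (i, j)) \<in> borel_measurable (borel_orthogonal_group n)"
      by (subst measurable_cong[OF *]) simp_all
  qed (simp add: orthogonal_group_transpose)
  then have "(\<lambda>p. (transpose_mat (fst p), snd p)) \<in> measurable
      (borel_orthogonal_group n \<Otimes>\<^sub>M PiM {..<n} (\<lambda>_. borel))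
      (borel_orthogonal_group n \<Otimes>\<^sub>M PiM {..<n} (\<lambda>_. borel))"
    by measurable
  from measurable_compose[OF this measurable_mat_apply_pair] show ?thesis
    by (simp add: case_prod_beta)
qed

text \<open>
  Scale-invariant functions depend only on the direction of a vector, so that \<open>U x\<close> can be compared
  with a Gaussian vector without normalizing either of them.
\<close>

definition scale_invariant :: "nat \<Rightarrow> ((nat \<Rightarrow> real) \<Rightarrow> ennreal) \<Rightarrow> bool" where
  "scale_invariant n f \<longleftrightarrow> (\<forall>c x. 0 < c \<longrightarrow> f (\<lambda>i\<in>{..<n}. c * x i) = f x)"

lemma mat_apply_scale:
  "mat_apply n A (\<lambda>i\<in>{..<n}. c * x i) = (\<lambda>i\<in>{..<n}. c * mat_apply n A x i)"
  by (auto simp: mat_apply_def fun_eq_iff sum_distrib_left mult.left_commute)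

context
  fixes n :: nat and \<mu> :: "real mat measure" and f :: "(nat \<Rightarrow> real) \<Rightarrow> ennreal"
  assumes haar: "normalized_haar_measure n \<mu>"
    and f [measurable]: "f \<in> borel_measurable (PiM {..<n} (\<lambda>_. borel))"
    and scale: "scale_invariant n f"
begin

lemma haar_sets [measurable_cong]: "sets \<mu> = sets (borel_orthogonal_group n)"
  using haar by (simp add: normalized_haar_measure_def)

lemma haar_space: "space \<mu> = orthogonal_group n"
  using sets_eq_imp_space_eq[OF haar_sets] by simp

lemma haar_prob_space: "prob_space \<mu>"
  using haar by (simp add: normalized_haar_measure_def)

lemma haar_invariant:
  assumes "Q \<in> orthogonal_group n" and [measurable]: "g \<in> borel_measurable (borel_orthogonal_group n)"
  shows "(\<integral>\<^sup>+A. g (Q * A) \<partial>\<mu>) = integral\<^sup>N \<mu> g"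
proof -
  note [measurable] = measurable_mult_orthogonal[OF assms(1)]
  have "integral\<^sup>N \<mu> g = integral\<^sup>N (distr \<mu> \<mu> (\<lambda>A. Q * A)) g"
    using haar assms(1) by (simp add: normalized_haar_measure_def)
  also have "\<dots> = (\<integral>\<^sup>+A. g (Q * A) \<partial>\<mu>)"
    by (rule nn_integral_distr) measurable
  finally show ?thesis ..
qed

definition haar_average :: "(nat \<Rightarrow> real) \<Rightarrow> ennreal" where
  "haar_average v = (\<integral>\<^sup>+A. f (mat_apply n (transpose_mat A) v) \<partial>\<mu>)"

lemma measurable_haar_average_integrand:
  assumes "v \<in> extensional {..<n}"
  shows "(\<lambda>A. f (mat_apply n (transpose_mat A) v)) \<in> borel_measurable (borel_orthogonal_group n)"
proof -
  have "v \<in> space (PiM {..<n} (\<lambda>_. borel))"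
    using assms by (simp add: space_PiM PiE_def)
  from measurable_compose[OF measurable_Pair1[OF measurable_mat_apply_transpose_pair this] f]
  show ?thesis by simp
qed

text \<open>
  An orthogonal \<open>Q\<close> with \<open>Q v = w\<close> gives \<open>A\<^sup>T w = (Q\<^sup>T A)\<^sup>T v\<close>, and \<open>Q\<^sup>T A\<close> has the same law as \<open>A\<close>.
  The transpose in the definition of \<open>haar_average\<close> turns the left invariance of the measure into a
  statement about the vector on which the matrix acts.  Lengths are adjusted by scale invariance.
\<close>

lemma haar_average_constant:
  assumes v: "v \<in> extensional {..<n}" "sqnorm n v \<noteq> 0"
    and w: "w \<in> extensional {..<n}" "sqnorm n w \<noteq> 0"
  shows "haar_average v = haar_average w"
proof -
  define c where "c = sqrt (sqnorm n v / sqnorm n w)"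
  have pos: "sqnorm n v > 0" "sqnorm n w > 0"
    using v w sqnorm_nonneg by (simp_all add: less_le)
  then have c: "c > 0" by (simp add: c_def)
  define w' where "w' = (\<lambda>i\<in>{..<n}. c * w i)"
  have "sqnorm n v = sqnorm n w'"
    using pos by (simp add: w'_def sqnorm_scale c_def)
  moreover have "w' \<in> extensional {..<n}" by (simp add: w'_def)
  moreover define Q where "Q = reflection n (\<lambda>i. v i - w' i)"
  ultimately have Qv: "mat_apply n Q v = w'" and Q: "Q \<in> orthogonal_group n"
    by (simp_all add: reflection_swaps reflection_orthogonal)
  have QT: "transpose_mat Q = Q" by (simp add: Q_def reflection_symmetric)
  have "haar_average w' = (\<integral>\<^sup>+A. f (mat_apply n (transpose_mat (Q * A)) v) \<partial>\<mu>)"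
    unfolding haar_average_def Qv[symmetric]
  proof (intro nn_integral_cong arg_cong[where f = f])
    fix A assume "A \<in> space \<mu>"
    then have A: "A \<in> carrier_mat n n" by (simp add: haar_space orthogonal_group_carrier)
    have Qc: "Q \<in> carrier_mat n n" using Q by (rule orthogonal_group_carrier)
    show "mat_apply n (transpose_mat A) (mat_apply n Q v) = mat_apply n (transpose_mat (Q * A)) v"
      using A Qc by (simp add: transpose_mult[OF Qc A] QT mat_apply_mult)
  qed
  also have "\<dots> = haar_average v"
    unfolding haar_average_def
    using Q v by (intro haar_invariant measurable_haar_average_integrand)
  finally have "haar_average v = haar_average w'" ..
  also have "haar_average w' = haar_average w"
    unfolding haar_average_def
  proof (intro nn_integral_cong)
    fix A
    have "f (\<lambda>i\<in>{..<n}. c * mat_apply n (transpose_mat A) w i) = f (mat_apply n (transpose_mat A) w)"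
      using scale c by (simp only: scale_invariant_def)
    then show "f (mat_apply n (transpose_mat A) w') = f (mat_apply n (transpose_mat A) w)"
      by (simp only: w'_def mat_apply_scale)
  qed
  finally show ?thesis .
qed

text \<open>
  \<open>\<integral>f d\<nu> = \<integral>\<integral>f (A\<^sup>T x) d\<nu> d\<mu>\<close> by rotation invariance of \<open>\<nu>\<close>; after exchanging the integrals, the inner
  one is the constant \<open>haar_average\<close>.
\<close>

lemma nn_integral_rotation_invariant:
  assumes \<nu>: "prob_space \<nu>" and [measurable_cong]: "sets \<nu> = sets (PiM {..<n} (\<lambda>_. borel))"
    and inv: "\<And>Q. Q \<in> orthogonal_group n \<Longrightarrow> (\<integral>\<^sup>+x. f (mat_apply n Q x) \<partial>\<nu>) = integral\<^sup>N \<nu> f"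
    and nz: "AE x in \<nu>. sqnorm n x \<noteq> 0"
    and e: "e \<in> extensional {..<n}" "sqnorm n e \<noteq> 0"
  shows "integral\<^sup>N \<nu> f = haar_average e"
proof -
  interpret \<mu>: prob_space \<mu> by (rule haar_prob_space)
  interpret \<nu>: prob_space \<nu> by (rule \<nu>)
  interpret pair_sigma_finite \<mu> \<nu>
    by (intro pair_sigma_finite.intro \<mu>.sigma_finite_measure_axioms \<nu>.sigma_finite_measure_axioms)
  note [measurable] = measurable_mat_apply_transpose_pair
  have sp: "space \<nu> = space (PiM {..<n} (\<lambda>_. borel))"
    by (rule sets_eq_imp_space_eq) fact
  have "integral\<^sup>N \<nu> f = (\<integral>\<^sup>+A. integral\<^sup>N \<nu> f \<partial>\<mu>)"
    by (simp add: \<mu>.emeasure_space_1)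
  also have "\<dots> = (\<integral>\<^sup>+A. \<integral>\<^sup>+x. f (mat_apply n (transpose_mat A) x) \<partial>\<nu> \<partial>\<mu>)"
    by (intro nn_integral_cong inv[symmetric]) (simp add: haar_space orthogonal_group_transpose)
  also have "\<dots> = (\<integral>\<^sup>+x. haar_average x \<partial>\<nu>)"
    unfolding haar_average_def
    using measurable_compose[OF measurable_mat_apply_transpose_pair f]
    by (intro Fubini'[symmetric]) (simp add: case_prod_beta cong: measurable_cong_sets sets_pair_measure_cong)
  also have "\<dots> = (\<integral>\<^sup>+x. haar_average e \<partial>\<nu>)"
    using nz AE_space
  proof (intro nn_integral_cong_AE, eventually_elim)
    fix x assume "sqnorm n x \<noteq> 0" "x \<in> space \<nu>"
    then show "haar_average x = haar_average e"
      using e by (intro haar_average_constant) (auto simp: sp space_PiM PiE_def)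
  qed
  also have "\<dots> = haar_average e"
    by (simp add: \<nu>.emeasure_space_1)
  finally show ?thesis .
qed

theorem haar_image_eq_gaussian:
  assumes x: "x \<in> extensional {..<n}" "sqnorm n x \<noteq> 0"
  shows "(\<integral>\<^sup>+A. f (mat_apply n A x) \<partial>\<mu>) = integral\<^sup>N (gaussian n) f"
proof -
  interpret \<mu>: prob_space \<mu> by (rule haar_prob_space)
  let ?N = "PiM {..<n} (\<lambda>_. borel :: real measure)"
  have n: "0 < n" using x(2) by (auto simp: sqnorm_def intro: gr0I)
  have "x \<in> space ?N" using x by (simp add: space_PiM PiE_def)
  from measurable_Pair1[OF measurable_mat_apply_pair this]
  have mx [measurable]: "(\<lambda>A. mat_apply n A x) \<in> measurable (borel_orthogonal_group n) ?N" by simp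
  define \<nu> where "\<nu> = distr \<mu> ?N (\<lambda>A. mat_apply n A x)"
  have \<nu>_int: "integral\<^sup>N \<nu> g = (\<integral>\<^sup>+A. g (mat_apply n A x) \<partial>\<mu>)"
    if [measurable]: "g \<in> borel_measurable ?N" for g
    unfolding \<nu>_def by (rule nn_integral_distr) measurable
  have "integral\<^sup>N \<nu> f = haar_average x"
  proof (rule nn_integral_rotation_invariant)
    show "prob_space \<nu>" unfolding \<nu>_def by (rule \<mu>.prob_space_distr) measurable
    show "AE y in \<nu>. sqnorm n y \<noteq> 0"
      unfolding \<nu>_def using x
      by (subst AE_distr_iff) (auto simp: sqnorm_mat_apply haar_space intro!: AE_I2)
    fix Q assume Q: "Q \<in> orthogonal_group n"
    have "(\<integral>\<^sup>+y. f (mat_apply n Q y) \<partial>\<nu>) = (\<integral>\<^sup>+A. f (mat_apply n Q (mat_apply n A x)) \<partial>\<mu>)"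
      by (rule \<nu>_int) measurable
    also have "\<dots> = (\<integral>\<^sup>+A. f (mat_apply n (Q * A) x) \<partial>\<mu>)"
      using Q by (intro nn_integral_cong)
        (simp add: haar_space orthogonal_group_carrier mat_apply_mult)
    also have "\<dots> = (\<integral>\<^sup>+A. f (mat_apply n A x) \<partial>\<mu>)"
      using Q by (intro haar_invariant) measurable
    finally show "(\<integral>\<^sup>+y. f (mat_apply n Q y) \<partial>\<nu>) = integral\<^sup>N \<nu> f"
      by (simp add: \<nu>_int)
  qed (use x in \<open>auto simp: \<nu>_def\<close>)
  moreover have "integral\<^sup>N (gaussian n) f = haar_average x"
  proof (rule nn_integral_rotation_invariant)
    have "AE y in std_normal_distribution. y \<noteq> (0::real)"
      by (subst AE_density) (auto intro: eventually_mono[OF AE_lborel_singleton])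
    then have "AE y in gaussian n. y 0 \<noteq> 0"
      using n by (intro AE_PiM_component prob_space_std_normal) auto
    then show "AE y in gaussian n. sqnorm n y \<noteq> 0"
      by eventually_elim (use n in \<open>auto simp: sqnorm_eq_0_iff\<close>)
  qed (use x in \<open>auto simp: prob_space_gaussian sets_gaussian nn_integral_gaussian_orthogonal\<close>)
  ultimately show ?thesis by (simp add: \<nu>_int)
qed

end

section \<open>Empirical distribution of a Gaussian vector\<close>

definition ecdf :: "nat \<Rightarrow> (nat \<Rightarrow> real) \<Rightarrow> real \<Rightarrow> real" where
  "ecdf n x t = (\<Sum>k<n. indicator {..t} (x k)) / real n"

abbreviation \<Phi> :: "real \<Rightarrow> real" where
  "\<Phi> \<equiv> cdf std_normal_distribution"

lemma ecdf_mono: "s \<le> t \<Longrightarrow> ecdf n x s \<le> ecdf n x t"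
  unfolding ecdf_def by (intro divide_right_mono sum_mono) (auto simp: indicator_def)

lemma ecdf_nonneg: "0 \<le> ecdf n x t"
  by (simp add: ecdf_def sum_nonneg)

lemma ecdf_le_1: "ecdf n x t \<le> 1"
proof -
  have "(\<Sum>k<n. indicator {..t} (x k)) \<le> (\<Sum>k<n. 1 :: real)"
    by (intro sum_mono) (auto simp: indicator_def)
  then show ?thesis by (cases "n = 0") (simp_all add: ecdf_def)
qed

lemma ecdf_scale: "0 < c \<Longrightarrow> ecdf n (\<lambda>i\<in>{..<n}. c * x i) (c * t) = ecdf n x t"
  unfolding ecdf_def by (intro arg_cong2[where f = "(/)"] sum.cong) (auto simp: indicator_def)

lemma measurable_ecdf [measurable]:
  assumes [measurable]: "t \<in> borel_measurable (PiM {..<n} (\<lambda>_. borel))"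
  shows "(\<lambda>x. ecdf n x (t x)) \<in> borel_measurable (PiM {..<n} (\<lambda>_. borel))"
proof -
  have "ecdf n x s = (\<Sum>k<n. if x k \<le> s then 1 else 0) / real n" for x s
    unfolding ecdf_def by (intro arg_cong2[where f = "(/)"] sum.cong) (auto simp: indicator_def)
  then show ?thesis by simp
qed

lemma std_normal_cdf_eq:
  "\<Phi> x = (1 / sqrt (2 * pi)) * (LINT u:{..x}|lborel. exp (- (u\<^sup>2 / 2)))"
proof -
  interpret real_distribution std_normal_distribution by (rule real_dist_normal_dist)
  have "ennreal (\<Phi> x) = (\<integral>\<^sup>+u. ennreal (std_normal_density u * indicator {..x} u) \<partial>lborel)"
    unfolding cdf_def2 emeasure_eq_measure[symmetric]
    by (subst emeasure_density) (auto simp: ennreal_mult' ennreal_indicator intro!: nn_integral_cong)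
  also have "\<dots> = ennreal (\<integral>u. std_normal_density u * indicator {..x} u \<partial>lborel)"
    by (intro nn_integral_eq_integral integrable_real_mult_indicator) auto
  finally have "\<Phi> x = (\<integral>u. std_normal_density u * indicator {..x} u \<partial>lborel)"
    by (subst (asm) ennreal_inj) (auto simp: cdf_nonneg)
  also have "\<dots> = (\<integral>u. (1 / sqrt (2 * pi)) * (indicator {..x} u *\<^sub>R exp (- (u\<^sup>2 / 2))) \<partial>lborel)"
    by (intro Bochner_Integration.integral_cong) (auto simp: std_normal_density_def)
  finally show ?thesis
    unfolding set_lebesgue_integral_def by simp
qed

lemma isCont_std_normal_cdf: "isCont \<Phi> x"
proof -
  interpret real_distribution std_normal_distribution by (rule real_dist_normal_dist)
  have "emeasure std_normal_distribution {x} = (\<integral>\<^sup>+u. ennreal (std_normal_density u) * indicator {x} u \<partial>lborel)"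
    by (rule emeasure_density) auto
  also have "\<dots> = 0" 
    by (subst nn_integral_indicator_singleton) auto
  finally show ?thesis
    unfolding isCont_cdf by (simp add: measure_def)
qed

lemma indep_vars_gaussian:
  assumes "0 < n"
  shows "prob_space.indep_vars (gaussian n) (\<lambda>_. borel) (\<lambda>k x. x k) {..<n}"
proof -
  interpret prob_space "gaussian n" by (rule prob_space_gaussian)
  have comp: "distr (gaussian n) borel (\<lambda>x. x k) = std_normal_distribution" if "k < n" for k
  proof -
    have "distr (gaussian n) borel (\<lambda>x. x k) = distr (gaussian n) std_normal_distribution (\<lambda>x. x k)"
      by (intro distr_cong) auto
    also have "\<dots> = std_normal_distribution"
      using that by (intro distr_PiM_component prob_space_std_normal) auto
    finally show ?thesis .
  qed
  have "distr (gaussian n) (PiM {..<n} (\<lambda>_. borel)) (\<lambda>x. \<lambda>k\<in>{..<n}. x k)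
      = distr (gaussian n) (gaussian n) (\<lambda>x. x)"
    by (intro distr_cong) (auto simp: sets_gaussian space_PiM PiE_def extensional_restrict)
  also have "\<dots> = gaussian n"
    by (rule distr_id)
  also have "\<dots> = PiM {..<n} (\<lambda>k. distr (gaussian n) borel (\<lambda>x. x k))"
    by (intro PiM_cong) (auto simp: comp)
  finally show ?thesis
    using assms by (subst indep_vars_iff_distr_eq_PiM') auto
qed

lemma gaussian_ecdf_tail:
  assumes n: "0 < n" and \<epsilon>: "0 \<le> \<epsilon>"
  shows "measure (gaussian n) {x \<in> space (gaussian n). \<bar>ecdf n x t - \<Phi> t\<bar> \<ge> \<epsilon>}
    \<le> 2 * exp (- 2 * real n * \<epsilon>\<^sup>2)"
proof -
  interpret prob_space "gaussian n" by (rule prob_space_gaussian)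
  define X :: "nat \<Rightarrow> (nat \<Rightarrow> real) \<Rightarrow> real" where "X k x = indicator {..t} (x k)" for k x
  have dist: "distr (gaussian n) borel (X k) = distr std_normal_distribution borel (indicator {..t})"
    if "k < n" for k
  proof -
    have "distr (gaussian n) borel (X k) = distr (distr (gaussian n) std_normal_distribution (\<lambda>x. x k)) borel (indicator {..t})"
      unfolding X_def using that by (subst distr_distr) (auto simp: o_def)
    also have "distr (gaussian n) std_normal_distribution (\<lambda>x. x k) = std_normal_distribution"
      using that by (intro distr_PiM_component prob_space_std_normal) auto
    finally show ?thesis .
  qed
  have X0 [measurable]: "X 0 \<in> borel_measurable (gaussian n)"
    unfolding X_def by measurable (use n in auto)
  interpret H: Hoeffding_ineq_iid "gaussian n" "{..<n}" X "X 0" 0 1 "expectation (X 0)"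
  proof unfold_locales
    show "indep_vars (\<lambda>_. borel) X {..<n}"
      unfolding X_def by (rule indep_vars_compose2[OF indep_vars_gaussian[OF n]]) auto
  qed (auto simp: dist n X_def)
  have "expectation (X 0) = (\<integral>y. y \<partial>distr (gaussian n) borel (X 0))"
    by (rule integral_distr[symmetric]) auto
  also have "\<dots> = (\<integral>y. indicator {..t} y \<partial>std_normal_distribution)"
    unfolding dist[OF n] by (rule integral_distr) auto
  also have "\<dots> = \<Phi> t"
    by (simp add: cdf_def)
  finally have mean: "expectation (X 0) = \<Phi> t" .
  have "prob {x \<in> space (gaussian n). \<bar>(\<Sum>k<n. X k x) / real (card {..<n}) - \<Phi> t\<bar> \<ge> \<epsilon>}
      \<le> 2 * exp (- 2 * real (card {..<n}) * \<epsilon>\<^sup>2 / (1 - 0)\<^sup>2)"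
    unfolding mean[symmetric] using \<epsilon> n by (intro H.Hoeffding_ineq_abs_ge') auto
  then show ?thesis by (simp add: ecdf_def X_def)
qed

text \<open>
  Up to a factor, \<open>exp (s x\<^sup>2)\<close> times the standard normal density is the normal density with variance
  \<open>1 / (1 - 2 s)\<close>.
\<close>

lemma nn_integral_std_normal_exp_square:
  assumes s: "s < 1 / 2"
  shows "(\<integral>\<^sup>+x. ennreal (exp (s * x\<^sup>2)) \<partial>std_normal_distribution) = ennreal (1 / sqrt (1 - 2 * s))"
proof -
  define \<sigma> where "\<sigma> = 1 / sqrt (1 - 2 * s)"
  have \<sigma>: "\<sigma> > 0" "\<sigma>\<^sup>2 = 1 / (1 - 2 * s)" using s by (auto simp: \<sigma>_def power_divide)
  have *: "std_normal_density x * exp (s * x\<^sup>2) = \<sigma> * normal_density 0 \<sigma> x" for x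
  proof -
    have "sqrt (2 * pi * \<sigma>\<^sup>2) = sqrt (2 * pi) * \<sigma>"
      using \<sigma>(1) by (simp add: real_sqrt_mult)
    moreover have "- x\<^sup>2 / 2 + s * x\<^sup>2 = - x\<^sup>2 / (2 * \<sigma>\<^sup>2)"
      using s unfolding \<sigma>(2) by (simp add: field_simps)
    ultimately show ?thesis
      using \<sigma>(1) by (simp add: normal_density_def flip: exp_add)
  qed
  have "(\<integral>\<^sup>+x. ennreal (exp (s * x\<^sup>2)) \<partial>std_normal_distribution)
      = (\<integral>\<^sup>+x. ennreal (std_normal_density x) * ennreal (exp (s * x\<^sup>2)) \<partial>lborel)"
    by (intro nn_integral_density) auto
  also have "\<dots> = (\<integral>\<^sup>+x. ennreal (\<sigma> * normal_density 0 \<sigma> x) \<partial>lborel)"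
    by (intro nn_integral_cong) (simp add: * flip: ennreal_mult)
  also have "\<dots> = ennreal (\<integral>x. \<sigma> * normal_density 0 \<sigma> x \<partial>lborel)"
    using \<sigma>(1) by (intro nn_integral_eq_integral) auto
  finally show ?thesis
    using \<sigma>(1) by (simp add: \<sigma>_def)
qed

text \<open>
  The factor \<open>a - 1\<close> makes this the upper tail for \<open>a > 1\<close> and the lower tail for \<open>a < 1\<close>.
\<close>

lemma gaussian_sqnorm_tail:
  assumes a: "0 < a"
  shows "measure (gaussian n) {x \<in> space (gaussian n). 0 \<le> (a - 1) * (sqnorm n x - a * real n)}
    \<le> (sqrt a * exp ((1 - a) / 2)) ^ n"
proof -
  interpret prob_space "gaussian n" by (rule prob_space_gaussian)
  interpret N: product_sigma_finite "\<lambda>_::nat. std_normal_distribution"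
    using prob_space_std_normal by (intro product_sigma_finite.intro prob_space_imp_sigma_finite)
  \<comment> \<open>The minimizer of the Chernoff bound \<open>exp (- s a) / sqrt (1 - 2 s)\<close>; it has the sign of \<open>a - 1\<close>.\<close>
  define s where "s = (1 - 1 / a) / 2"
  have s: "s < 1 / 2" "1 - 2 * s = 1 / a" "s * a = (a - 1) / 2" and s': "s = (a - 1) / (2 * a)"
    using a by (auto simp: s_def field_simps)
  define g where "g x = s * (sqnorm n x - a * real n)" for x
  have g: "g x = (a - 1) * (sqnorm n x - a * real n) / (2 * a)" for x
    by (simp add: g_def s')
  have g_exp: "ennreal (exp (g x)) = ennreal (exp ((1 - a) / 2) ^ n) * (\<Prod>i<n. ennreal (exp (s * (x i)\<^sup>2)))"
    for x
  proof -
    have "exp (g x) = exp (real n * ((1 - a) / 2)) * exp (\<Sum>i<n. s * (x i)\<^sup>2)"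
    proof -
      have "s * (a * real n) = - (real n * ((1 - a) / 2))"
        unfolding mult.assoc[symmetric] s(3) by (simp add: field_simps)
      then have "g x = real n * ((1 - a) / 2) + (\<Sum>i<n. s * (x i)\<^sup>2)"
        by (simp add: g_def sqnorm_def right_diff_distrib sum_distrib_left)
      then show ?thesis by (simp only: exp_add)
    qed
    also have "\<dots> = exp ((1 - a) / 2) ^ n * (\<Prod>i<n. exp (s * (x i)\<^sup>2))"
      by (simp only: exp_of_nat_mult exp_sum[OF finite_lessThan])
    finally show ?thesis
      by (simp only:) (simp add: ennreal_mult prod_ennreal prod_nonneg)
  qed
  have set_eq: "{x \<in> space (gaussian n). 0 \<le> (a - 1) * (sqnorm n x - a * real n)}
      = {x \<in> space (gaussian n). g x \<ge> 0}"
    using a by (auto simp: g zero_le_divide_iff)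
  have "ennreal (prob {x \<in> space (gaussian n). 0 \<le> (a - 1) * (sqnorm n x - a * real n)})
      = emeasure (gaussian n) {x \<in> space (gaussian n). g x \<ge> 0}"
    unfolding set_eq by (simp add: emeasure_eq_measure)
  also have "\<dots> \<le> ennreal (exp (- 1 * 0)) * (\<integral>\<^sup>+x\<in>space (gaussian n). ennreal (exp (1 * g x)) \<partial>gaussian n)"
    unfolding g_def by (intro Chernoff_ineq_nn_integral_ge) auto
  also have "\<dots> = (\<integral>\<^sup>+x. ennreal (exp (g x)) \<partial>gaussian n)"
    by (auto intro!: nn_integral_cong)
  also have "\<dots> = ennreal (exp ((1 - a) / 2) ^ n) * (\<integral>\<^sup>+x. (\<Prod>i<n. ennreal (exp (s * (x i)\<^sup>2))) \<partial>gaussian n)"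
    unfolding g_exp by (intro nn_integral_cmult) measurable
  also have "(\<integral>\<^sup>+x. (\<Prod>i<n. ennreal (exp (s * (x i)\<^sup>2))) \<partial>gaussian n)
      = (\<Prod>i<n. \<integral>\<^sup>+x. ennreal (exp (s * x\<^sup>2)) \<partial>std_normal_distribution)"
    by (rule N.product_nn_integral_prod) auto
  also have "\<dots> = ennreal (sqrt a ^ n)"
    using s(1) a by (simp add: nn_integral_std_normal_exp_square s(2) ennreal_power real_sqrt_divide)
  also have "ennreal (exp ((1 - a) / 2) ^ n) * ennreal (sqrt a ^ n) = ennreal ((sqrt a * exp ((1 - a) / 2)) ^ n)"
    using a by (simp add: power_mult_distrib mult.commute flip: ennreal_mult)
  finally show ?thesis
    using a by simp
qed

lemma sqrt_times_exp_less_1: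
  fixes a :: real
  assumes "0 < a" "a \<noteq> 1"
  shows "sqrt a * exp ((1 - a) / 2) < 1"
proof -
  have "ln a < a - 1"
    using ln_le_minus_one[OF assms(1)] ln_eq_minus_one[OF assms(1)] assms(2) by fastforce
  moreover have "ln (sqrt a * exp ((1 - a) / 2)) = ln a / 2 + (1 - a) / 2"
    using assms(1) by (simp add: ln_mult ln_sqrt)
  ultimately have "ln (sqrt a * exp ((1 - a) / 2)) < 0"
    by (simp add: field_simps)
  then show ?thesis
    using assms(1) by simp
qed

text \<open>
  As long as \<open>\<bar>G\<bar>\<close> lies between \<open>(1 - \<delta>) \<surd>n\<close> and \<open>(1 + \<delta>) \<surd>n\<close>, the random argument of the empirical
  distribution function lies between two fixed points close to \<open>y\<close>.  So it suffices to control the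
  length and the values at these two points.
\<close>

lemma gaussian_normalized_ecdf_summable_tail:
  fixes y \<epsilon> :: real
  assumes \<epsilon>: "0 < \<epsilon>"
  obtains b where "summable b"
    "\<And>n. 0 < n \<Longrightarrow> measure (gaussian n)
       {x \<in> space (gaussian n). \<epsilon> < \<bar>ecdf n x (y * sqrt (sqnorm n x / real n)) - \<Phi> y\<bar>} \<le> b n"
proof -
  have "isCont (\<lambda>t. \<Phi> (y * t)) 1"
    by (rule isCont_o2[where f = "\<lambda>t. y * t"]) (simp_all add: isCont_std_normal_cdf)
  then obtain d where d: "d > 0" "\<And>t. \<bar>t - 1\<bar> < d \<Longrightarrow> \<bar>\<Phi> (y * t) - \<Phi> y\<bar> < \<epsilon> / 2"
    using \<epsilon> unfolding continuous_at_eps_delta dist_real_def by (metis half_gt_zero mult.right_neutral)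
  define \<delta> where "\<delta> = min (d / 2) (1 / 2)"
  have \<delta>: "0 < \<delta>" "\<delta> < 1" "\<delta> < d" using d(1) by (auto simp: \<delta>_def)
  define lo hi where "lo = min (y * (1 - \<delta>)) (y * (1 + \<delta>))" and "hi = max (y * (1 - \<delta>)) (y * (1 + \<delta>))"
  have close: "\<bar>\<Phi> lo - \<Phi> y\<bar> < \<epsilon> / 2" "\<bar>\<Phi> hi - \<Phi> y\<bar> < \<epsilon> / 2"
    using \<delta> d(2)[of "1 - \<delta>"] d(2)[of "1 + \<delta>"] by (auto simp: lo_def hi_def min_def max_def)
  have between: "lo \<le> y * r \<and> y * r \<le> hi" if "1 - \<delta> \<le> r" "r \<le> 1 + \<delta>" for r
  proof (cases "0 \<le> y")
    case True
    then have "y * (1 - \<delta>) \<le> y * r" "y * r \<le> y * (1 + \<delta>)"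
      using that by (intro mult_left_mono; simp)+
    then show ?thesis by (simp only: lo_def hi_def min_le_iff_disj le_max_iff_disj) simp
  next
    case False
    then have "y * r \<le> y * (1 - \<delta>)" "y * (1 + \<delta>) \<le> y * r"
      using that by (intro mult_left_mono_neg; simp)+
    then show ?thesis by (simp only: lo_def hi_def min_le_iff_disj le_max_iff_disj) simp
  qed
  define q where "q a = sqrt a * exp ((1 - a) / 2)" for a :: real
  let ?a = "(1 - \<delta>)\<^sup>2" and ?b = "(1 + \<delta>)\<^sup>2"
  define b where "b n = q ?a ^ n + q ?b ^ n + 4 * exp (- 2 * (\<epsilon> / 2)\<^sup>2) ^ n" for n :: nat
  have ab: "0 < ?a" "?a < 1" "1 < ?b" "0 < ?b"
    using \<delta> power_strict_mono[of "1 - \<delta>" 1 2] power_strict_mono[of 1 "1 + \<delta>" 2] by simp_all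
  show ?thesis
  proof
    have "0 \<le> q ?a" "q ?a < 1" "0 \<le> q ?b" "q ?b < 1"
      using ab sqrt_times_exp_less_1[of ?a] sqrt_times_exp_less_1[of ?b] by (auto simp: q_def)
    then show "summable b"
      unfolding b_def using \<epsilon> by (intro summable_add summable_mult summable_geometric) auto
    fix n :: nat assume n: "0 < n"
    interpret prob_space "gaussian n" by (rule prob_space_gaussian)
    let ?S = "space (gaussian n)"
    let ?r = "\<lambda>x. sqrt (sqnorm n x / real n)"
    define A where "A = {x \<in> ?S. 0 \<le> (?a - 1) * (sqnorm n x - ?a * real n)}"
    define B where "B = {x \<in> ?S. 0 \<le> (?b - 1) * (sqnorm n x - ?b * real n)}"
    define C where "C t = {x \<in> ?S. \<bar>ecdf n x t - \<Phi> t\<bar> \<ge> \<epsilon> / 2}" for t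
    have [measurable]: "A \<in> sets (gaussian n)" "B \<in> sets (gaussian n)" "C t \<in> sets (gaussian n)" for t
      unfolding A_def B_def C_def ecdf_def by measurable
    have "x \<in> A \<union> B \<union> (C lo \<union> C hi)"
      if x: "x \<in> ?S" "\<epsilon> < \<bar>ecdf n x (y * ?r x) - \<Phi> y\<bar>" for x
    proof (rule ccontr)
      assume "\<not> ?thesis"
      then have nA: "x \<notin> A" and nB: "x \<notin> B" and nC: "x \<notin> C lo" "x \<notin> C hi" by auto
      have "?a * real n < sqnorm n x"
        using nA x(1) ab(2) by (auto simp: A_def zero_le_mult_iff)
      then have "(1 - \<delta>)\<^sup>2 \<le> sqnorm n x / real n"
        using n by (simp add: field_simps)
      then have "1 - \<delta> \<le> ?r x"
        by (rule real_le_rsqrt)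
      moreover have "sqnorm n x < ?b * real n"
        using nB x(1) ab(3) by (auto simp: B_def zero_le_mult_iff)
      then have "sqnorm n x / real n \<le> (1 + \<delta>)\<^sup>2"
        using n by (simp add: field_simps)
      then have "?r x \<le> 1 + \<delta>"
        using \<delta> by (intro real_le_lsqrt) auto
      ultimately have "ecdf n x lo \<le> ecdf n x (y * ?r x)" "ecdf n x (y * ?r x) \<le> ecdf n x hi"
        using between by (auto intro: ecdf_mono)
      moreover have "\<bar>ecdf n x lo - \<Phi> lo\<bar> < \<epsilon> / 2" "\<bar>ecdf n x hi - \<Phi> hi\<bar> < \<epsilon> / 2"
        using nC x(1) by (auto simp: C_def)
      ultimately show False
        using close x(2) by linarith
    qed
    then have "prob {x \<in> ?S. \<epsilon> < \<bar>ecdf n x (y * ?r x) - \<Phi> y\<bar>} \<le> prob (A \<union> B \<union> (C lo \<union> C hi))"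
      by (intro finite_measure_mono) auto
    also have "\<dots> \<le> (prob A + prob B) + (prob (C lo) + prob (C hi))"
      by (intro order.trans[OF measure_Un_le] add_mono measure_Un_le) auto
    also have "\<dots> \<le> (q ?a ^ n + q ?b ^ n)
        + (2 * exp (- 2 * real n * (\<epsilon> / 2)\<^sup>2) + 2 * exp (- 2 * real n * (\<epsilon> / 2)\<^sup>2))"
      unfolding A_def B_def C_def q_def
      using \<epsilon> n ab by (intro add_mono gaussian_sqnorm_tail gaussian_ecdf_tail) auto
    also have "exp (- 2 * real n * (\<epsilon> / 2)\<^sup>2) = exp (- 2 * (\<epsilon> / 2)\<^sup>2) ^ n"
      by (simp add: mult.assoc mult.left_commute flip: exp_of_nat_mult)
    finally show "prob {x \<in> ?S. \<epsilon> < \<bar>ecdf n x (y * ?r x) - \<Phi> y\<bar>} \<le> b n"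
      by (simp add: b_def)
  qed
qed

section \<open>A strong law of large numbers for squares\<close>

lemma (in prob_space) expectation_square_sum_indep:
  fixes Z :: "'i \<Rightarrow> 'a \<Rightarrow> real"
  assumes "finite I" and "indep_vars (\<lambda>_. borel) Z I"
    and "\<And>i. i \<in> I \<Longrightarrow> integrable M (\<lambda>x. (Z i x)\<^sup>2)"
    and "\<And>i. i \<in> I \<Longrightarrow> expectation (Z i) = 0"
  shows "integrable M (\<lambda>x. (\<Sum>i\<in>I. Z i x)\<^sup>2) \<and>
    expectation (\<lambda>x. (\<Sum>i\<in>I. Z i x)\<^sup>2) = (\<Sum>i\<in>I. expectation (\<lambda>x. (Z i x)\<^sup>2))"
  using assms
proof (induction I)
  case empty
  then show ?case by simp
next
  case (insert i I)
  let ?S = "\<lambda>x. \<Sum>i\<in>I. Z i x"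
  have rv [measurable]: "Z j \<in> borel_measurable M" if "j \<in> insert i I" for j
    using insert.prems(1) that by (auto simp: indep_vars_def)
  have IH: "integrable M (\<lambda>x. (?S x)\<^sup>2)"
    "expectation (\<lambda>x. (?S x)\<^sup>2) = (\<Sum>i\<in>I. expectation (\<lambda>x. (Z i x)\<^sup>2))"
    using insert.IH[OF indep_vars_subset[OF insert.prems(1)]] insert.prems by auto
  have int: "integrable M (Z j)" if "j \<in> insert i I" for j
    using that insert.prems(2) rv by (intro square_integrable_imp_integrable[of "Z j"]) auto
  have intS: "integrable M ?S" and ES: "expectation ?S = 0"
    using int insert.prems(3) by auto
  have ind: "indep_var borel (Z i) borel ?S"
    using insert by (intro indep_vars_sum) auto
  have intZS: "integrable M (\<lambda>x. Z i x * ?S x)"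
    by (rule indep_var_integrable[OF ind]) (use int intS in auto)
  have EZS: "expectation (\<lambda>x. Z i x * ?S x) = 0"
    using indep_var_lebesgue_integral[OF ind] int intS ES by simp
  have eq: "(\<Sum>j\<in>insert i I. Z j x)\<^sup>2 = (Z i x)\<^sup>2 + 2 * (Z i x * ?S x) + (?S x)\<^sup>2" for x
    using insert.hyps by (simp add: power2_sum)
  show ?case
    unfolding eq using insert.prems(2) insert.hyps IH intZS EZS by simp
qed

text \<open>
  The ratio of consecutive fourth powers tends to 1, so a monotone sequence cannot change
  much, relative to its size, between them.
\<close>

lemma monotone_average_limit:
  fixes s :: "nat \<Rightarrow> real"
  assumes mono: "mono s" and s0: "0 \<le> s 0"
    and lim: "(\<lambda>k. s (k ^ 4) / real (k ^ 4)) \<longlonglongrightarrow> 1"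
  shows "(\<lambda>n. s n / real n) \<longlonglongrightarrow> 1"
proof -
  \<comment> \<open>\<open>k n ^ 4\<close> is the largest fourth power that is at most \<open>n\<close>.\<close>
  define k where "k n = nat \<lfloor>root 4 (real n)\<rfloor>" for n
  define g where "g k = s (k ^ 4) / real (k ^ 4)" for k
  have k: "k n ^ 4 \<le> n" "n < (k n + 1) ^ 4" for n
  proof -
    have r: "real (k n) \<le> root 4 (real n)" "root 4 (real n) < real (k n + 1)"
      by (simp_all add: k_def) linarith
    have "real (k n) ^ 4 \<le> root 4 (real n) ^ 4"
      using r by (intro power_mono) auto
    moreover have "root 4 (real n) ^ 4 < real (k n + 1) ^ 4"
      using r by (intro power_strict_mono) auto
    ultimately have "real (k n ^ 4) \<le> real n" "real n < real ((k n + 1) ^ 4)"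
      by simp_all
    then show "k n ^ 4 \<le> n" "n < (k n + 1) ^ 4"
      by (simp_all only: of_nat_le_iff of_nat_less_iff)
  qed
  have k_top: "filterlim k at_top sequentially"
    unfolding filterlim_at_top
  proof
    fix K
    have "K \<le> k n" if "K ^ 4 \<le> n" for n
    proof (rule ccontr)
      assume "\<not> K \<le> k n"
      then have "(k n + 1) ^ 4 \<le> K ^ 4" by (intro power_mono) auto
      with k(2)[of n] that show False by linarith
    qed
    then show "\<forall>\<^sub>F n in sequentially. K \<le> k n"
      by (auto simp: eventually_sequentially)
  qed
  have g: "g \<longlonglongrightarrow> 1" using lim by (simp add: g_def[abs_def])
  have ratio: "(\<lambda>k. (real k / real (k + 1)) ^ 4) \<longlonglongrightarrow> 1 ^ 4" "(\<lambda>k. (real (k + 1) / real k) ^ 4) \<longlonglongrightarrow> 1 ^ 4"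
    by (intro tendsto_power; real_asymp)+
  have lo: "(\<lambda>k. g k * (real k / real (k + 1)) ^ 4) \<longlonglongrightarrow> 1"
    using tendsto_mult[OF g ratio(1)] by simp
  have hi: "(\<lambda>k. g (k + 1) * (real (k + 1) / real k) ^ 4) \<longlonglongrightarrow> 1"
    using tendsto_mult[OF LIMSEQ_ignore_initial_segment[OF g, of 1] ratio(2)] by simp
  have nonneg: "0 \<le> s n" for n using s0 monoD[OF mono, of 0 n] by simp
  have ev: "\<forall>\<^sub>F n in sequentially. 1 \<le> k n"
    using k_top unfolding filterlim_at_top by blast
  show ?thesis
  proof (rule real_tendsto_sandwich)
    show "\<forall>\<^sub>F n in sequentially. g (k n) * (real (k n) / real (k n + 1)) ^ 4 \<le> s n / real n"
      using ev
    proof eventually_elim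
      case (elim n)
      have "g (k n) * (real (k n) / real (k n + 1)) ^ 4 = s (k n ^ 4) / real ((k n + 1) ^ 4)"
        using elim by (simp add: g_def power_divide)
      also have "\<dots> \<le> s n / real n"
        using k[of n] elim monoD[OF mono k(1)[of n]] nonneg
        by (intro frac_le) (auto intro: gr0I simp del: of_nat_power)
      finally show ?case .
    qed
    show "\<forall>\<^sub>F n in sequentially. s n / real n \<le> g (k n + 1) * (real (k n + 1) / real (k n)) ^ 4"
      using ev
    proof eventually_elim
      case (elim n)
      have "s n / real n \<le> s ((k n + 1) ^ 4) / real (k n ^ 4)"
        using k[of n] elim monoD[OF mono less_imp_le[OF k(2)[of n]]] nonneg
        by (intro frac_le) (auto simp del: of_nat_power)
      also have "\<dots> = g (k n + 1) * (real (k n + 1) / real (k n)) ^ 4"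
        using elim by (simp add: g_def power_divide)
      finally show ?case .
    qed
  qed (rule filterlim_compose[OF lo k_top] filterlim_compose[OF hi k_top])+
qed

context prob_space
begin

context
  fixes X :: "nat \<Rightarrow> 'a \<Rightarrow> real" and C :: real
  assumes indep: "indep_vars (\<lambda>_. borel) X UNIV"
    and second: "\<And>j. expectation (\<lambda>\<omega>. (X j \<omega>)\<^sup>2) = 1"
    and third_int: "\<And>j. integrable M (\<lambda>\<omega>. \<bar>X j \<omega>\<bar> ^ 3)"
    and third: "\<And>j. expectation (\<lambda>\<omega>. \<bar>X j \<omega>\<bar> ^ 3) \<le> C"
begin

lemma measurable_indep_var [measurable]: "X j \<in> borel_measurable M"
  using indep by (auto simp: indep_vars_def)

text \<open>
  The squares are truncated at \<open>n\<close>.  By Markov's inequality for \<open>\<bar>X\<^sub>j\<bar>\<^sup>3\<close> the truncation has an effect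
  with probability at most \<open>n C / (n \<surd>n)\<close>; it lowers the means by at most \<open>C / \<surd>n\<close>; and the truncated
  squares have second moments at most \<open>C \<surd>n\<close>, as \<open>X\<^sub>j\<^sup>4 \<le> \<surd>n \<bar>X\<^sub>j\<bar>\<^sup>3\<close> wherever \<open>\<bar>X\<^sub>j\<bar> \<le> \<surd>n\<close>.  The three terms of the
  constant come from truncation, from Chebyshev's inequality, and from those small \<open>n\<close> for which the
  bias \<open>C / \<surd>n\<close> exceeds \<open>\<epsilon> / 2\<close> and the right-hand side is at least 1.
\<close>

lemma sum_squares_deviation:
  assumes n: "0 < n" and \<epsilon>: "0 < \<epsilon>"
  shows "prob {\<omega> \<in> space M. \<epsilon> < \<bar>(\<Sum>j<n. (X j \<omega>)\<^sup>2) / real n - 1\<bar>}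
    \<le> (C + 4 * C / \<epsilon>\<^sup>2 + 2 * C / \<epsilon>) / sqrt (real n)"
proof -
  have "0 \<le> expectation (\<lambda>\<omega>. \<bar>X 0 \<omega>\<bar> ^ 3)"
    by (intro integral_nonneg_AE) auto
  with third[of 0] have C: "0 \<le> C" by linarith
  let ?r = "sqrt (real n)"
  have r: "0 < ?r" "?r * ?r = real n" using n by auto
  show ?thesis
  proof (cases "C / ?r \<le> \<epsilon> / 2")
    case False
    then have "1 \<le> (2 * C / \<epsilon>) / ?r"
      using \<epsilon> r by (simp add: field_simps)
    also have "\<dots> \<le> (C + 4 * C / \<epsilon>\<^sup>2 + 2 * C / \<epsilon>) / ?r"
      using C \<epsilon> r by (intro divide_right_mono) auto
    finally show ?thesis using prob_le_1 by (rule order.trans[rotated])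
  next
    case small: True
    define Y where "Y j \<omega> = (X j \<omega>)\<^sup>2 * indicator {..?r} \<bar>X j \<omega>\<bar>" for j \<omega>
    have [measurable]: "Y j \<in> borel_measurable M" for j
      unfolding Y_def by measurable
    have Y_bounds: "0 \<le> Y j \<omega>" "Y j \<omega> \<le> real n" for j \<omega>
    proof -
      have "(X j \<omega>)\<^sup>2 \<le> real n" if "\<bar>X j \<omega>\<bar> \<le> ?r"
        using power_mono[OF that, of 2] by simp
      then show "0 \<le> Y j \<omega>" "Y j \<omega> \<le> real n"
        by (auto simp: Y_def indicator_def)
    qed
    have intY: "integrable M (Y j)" for j
      using Y_bounds by (intro integrable_const_bound[of _ "real n"]) auto
    have Y_sq: "(Y j \<omega>)\<^sup>2 \<le> ?r * \<bar>X j \<omega>\<bar> ^ 3" for j \<omega>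
    proof (cases "\<bar>X j \<omega>\<bar> \<le> ?r")
      case True
      then have "\<bar>X j \<omega>\<bar> * \<bar>X j \<omega>\<bar> ^ 3 \<le> ?r * \<bar>X j \<omega>\<bar> ^ 3"
        by (intro mult_right_mono) auto
      moreover have "(Y j \<omega>)\<^sup>2 = \<bar>X j \<omega>\<bar> * \<bar>X j \<omega>\<bar> ^ 3"
      proof -
        have "(Y j \<omega>)\<^sup>2 = \<bar>X j \<omega>\<bar> ^ 4" using True by (simp add: Y_def)
        then show ?thesis by (simp add: power_numeral_reduce)
      qed
      ultimately show ?thesis by simp
    qed (simp add: Y_def)
    have intX2: "integrable M (\<lambda>\<omega>. (X j \<omega>)\<^sup>2)" for j
      using second[of j] by (metis not_integrable_integral_eq zero_neq_one)
    have EY: "1 - C / ?r \<le> expectation (Y j)" "expectation (Y j) \<le> 1" for j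
    proof -
      have le: "(X j \<omega>)\<^sup>2 - \<bar>X j \<omega>\<bar> ^ 3 / ?r \<le> Y j \<omega>" for \<omega>
      proof (cases "\<bar>X j \<omega>\<bar> \<le> ?r")
        case False
        then have "(X j \<omega>)\<^sup>2 * ?r \<le> (X j \<omega>)\<^sup>2 * \<bar>X j \<omega>\<bar>"
          by (intro mult_left_mono) auto
        also have "\<dots> = \<bar>X j \<omega>\<bar> ^ 3" by (simp add: power3_eq_cube power2_eq_square)
        finally show ?thesis using False r by (simp add: Y_def field_simps)
      qed (simp add: Y_def)
      have "1 - C / ?r \<le> 1 - expectation (\<lambda>\<omega>. \<bar>X j \<omega>\<bar> ^ 3) / ?r"
        using third[of j] r by (simp add: divide_right_mono)
      also have "\<dots> = expectation (\<lambda>\<omega>. (X j \<omega>)\<^sup>2 - \<bar>X j \<omega>\<bar> ^ 3 / ?r)"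
        using intX2 third_int second by simp
      also have "\<dots> \<le> expectation (Y j)"
        using intX2 third_int intY le by (intro integral_mono) auto
      finally show "1 - C / ?r \<le> expectation (Y j)" .
      have "expectation (Y j) \<le> expectation (\<lambda>\<omega>. (X j \<omega>)\<^sup>2)"
        using intX2 intY by (intro integral_mono) (auto simp: Y_def indicator_def)
      then show "expectation (Y j) \<le> 1" by (simp add: second)
    qed
    define Z where "Z j \<omega> = Y j \<omega> - expectation (Y j)" for j \<omega>
    have [measurable]: "Z j \<in> borel_measurable M" for j
      unfolding Z_def by measurable
    have intY2: "integrable M (\<lambda>\<omega>. (Y j \<omega>)\<^sup>2)" for j
      using Y_bounds by (intro integrable_const_bound[of _ "(real n)\<^sup>2"]) (auto intro!: power_mono AE_I2)
    have intZ: "integrable M (\<lambda>\<omega>. (Z j \<omega>)\<^sup>2)" for j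
      unfolding Z_def power2_diff using intY intY2 by auto
    have EZ: "expectation (Z j) = 0" for j
      unfolding Z_def using intY by (simp add: prob_space)
    have EZ2: "expectation (\<lambda>\<omega>. (Z j \<omega>)\<^sup>2) \<le> ?r * C" for j
    proof -
      have "expectation (\<lambda>\<omega>. (Z j \<omega>)\<^sup>2) = expectation (\<lambda>\<omega>. (Y j \<omega>)\<^sup>2) - (expectation (Y j))\<^sup>2"
        unfolding Z_def using intY intY2 by (rule variance_eq)
      also have "\<dots> \<le> expectation (\<lambda>\<omega>. (Y j \<omega>)\<^sup>2)" by simp
      also have "\<dots> \<le> expectation (\<lambda>\<omega>. ?r * \<bar>X j \<omega>\<bar> ^ 3)"
        using Y_sq intY2 third_int by (intro integral_mono) auto
      also have "\<dots> \<le> ?r * C"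
        using third[of j] r(1) by simp
      finally show ?thesis .
    qed
    have indepZ: "indep_vars (\<lambda>_. borel) Z {..<n}"
      unfolding Z_def Y_def
      by (rule indep_vars_compose2[OF indep_vars_subset[OF indep]]) auto
    let ?T = "\<lambda>\<omega>. \<Sum>j<n. Z j \<omega>"
    have T: "integrable M (\<lambda>\<omega>. (?T \<omega>)\<^sup>2)" "expectation (\<lambda>\<omega>. (?T \<omega>)\<^sup>2) \<le> real n * (?r * C)"
      using expectation_square_sum_indep[OF _ indepZ intZ EZ] sum_mono[of "{..<n}", OF EZ2] by auto
    \<comment> \<open>Off these sets no square is affected by the truncation.\<close>
    define D where "D j = {\<omega> \<in> space M. real n * ?r \<le> \<bar>X j \<omega>\<bar> ^ 3}" for j
    define B where "B = {\<omega> \<in> space M. (real n * \<epsilon> / 2)\<^sup>2 \<le> (?T \<omega>)\<^sup>2}"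
    have [measurable]: "D j \<in> sets M" "B \<in> sets M" for j
      unfolding D_def B_def by measurable
    have PD: "prob (D j) \<le> C / (real n * ?r)" for j
    proof -
      have "prob (D j) \<le> expectation (\<lambda>\<omega>. \<bar>X j \<omega>\<bar> ^ 3) / (real n * ?r)"
        unfolding D_def using r n third_int
        by (intro integral_Markov_inequality_measure[of _ _ "{}"]) auto
      also have "\<dots> \<le> C / (real n * ?r)"
        using third r n by (intro divide_right_mono) auto
      finally show ?thesis .
    qed
    have PB: "prob B \<le> (4 * C / \<epsilon>\<^sup>2) / ?r"
    proof -
      have "prob B \<le> expectation (\<lambda>\<omega>. (?T \<omega>)\<^sup>2) / (real n * \<epsilon> / 2)\<^sup>2"
        unfolding B_def using T n \<epsilon>
        by (intro integral_Markov_inequality_measure[of _ _ "{}"]) auto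
      also have "\<dots> \<le> real n * (?r * C) / (real n * \<epsilon> / 2)\<^sup>2"
        using T by (intro divide_right_mono) auto
      also have "\<dots> = (?r * C * 4 / \<epsilon>\<^sup>2) / real n"
        using n \<epsilon> by (simp add: power2_eq_square field_simps)
      also have "\<dots> = (4 * C / \<epsilon>\<^sup>2) / ?r"
      proof -
        have "\<rho> * c / m = c / \<rho>" if "0 < \<rho>" "\<rho> * \<rho> = m" for \<rho> c m :: real
          using that by auto
        from this[OF r, of "4 * C / \<epsilon>\<^sup>2"] show ?thesis
          by (simp add: mult.commute mult.left_commute)
      qed
      finally show ?thesis .
    qed
    have "\<omega> \<in> (\<Union>j<n. D j) \<union> B"
      if \<omega>: "\<omega> \<in> space M" "\<epsilon> < \<bar>(\<Sum>j<n. (X j \<omega>)\<^sup>2) / real n - 1\<bar>" for \<omega>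
    proof (rule ccontr)
      assume not: "\<not> ?thesis"
      have "Y j \<omega> = (X j \<omega>)\<^sup>2" if "j < n" for j
      proof -
        have "\<bar>X j \<omega>\<bar> ^ 3 < real n * ?r"
          using not that \<omega>(1) by (auto simp: D_def not_le)
        also have "real n * ?r = ?r ^ 3" by (simp only: power3_eq_cube r(2))
        finally have "\<bar>X j \<omega>\<bar> < ?r" by (rule power_less_imp_less_base) simp
        then show ?thesis by (simp add: Y_def)
      qed
      then have "(\<Sum>j<n. (X j \<omega>)\<^sup>2) = ?T \<omega> + (\<Sum>j<n. expectation (Y j))"
        by (simp add: Z_def sum_subtractf)
      moreover have "(\<Sum>j<n. expectation (Y j)) \<le> real n"
        using sum_mono[of "{..<n}" "\<lambda>j. expectation (Y j)" "\<lambda>_. 1"] EY(2) by simp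
      moreover have "real n * (1 - \<epsilon> / 2) \<le> (\<Sum>j<n. expectation (Y j))"
      proof -
        have "1 - \<epsilon> / 2 \<le> expectation (Y j)" for j using EY(1)[of j] small by linarith
        then show ?thesis
          using sum_mono[of "{..<n}" "\<lambda>_. 1 - \<epsilon> / 2" "\<lambda>j. expectation (Y j)"] by simp
      qed
      moreover have "\<bar>?T \<omega>\<bar> < real n * \<epsilon> / 2"
      proof -
        have "(?T \<omega>)\<^sup>2 < (real n * \<epsilon> / 2)\<^sup>2"
          using not \<omega>(1) by (auto simp: B_def)
        then show ?thesis
          using \<epsilon> power2_less_imp_less[of "\<bar>?T \<omega>\<bar>" "real n * \<epsilon> / 2"] by simp
      qed
      ultimately have "\<bar>(\<Sum>j<n. (X j \<omega>)\<^sup>2) - real n\<bar> \<le> real n * \<epsilon>"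
        by (simp add: algebra_simps)
      then have "\<bar>(\<Sum>j<n. (X j \<omega>)\<^sup>2) / real n - 1\<bar> \<le> \<epsilon>"
        using n by (simp add: field_simps abs_le_iff)
      with \<omega>(2) show False by simp
    qed
    then have "prob {\<omega> \<in> space M. \<epsilon> < \<bar>(\<Sum>j<n. (X j \<omega>)\<^sup>2) / real n - 1\<bar>}
        \<le> prob ((\<Union>j<n. D j) \<union> B)"
      by (intro finite_measure_mono) auto
    also have "\<dots> \<le> prob (\<Union>j<n. D j) + prob B"
      by (intro measure_Un_le) auto
    also have "\<dots> \<le> (\<Sum>j<n. prob (D j)) + prob B"
      by (intro add_right_mono finite_measure_subadditive_finite) auto
    also have "\<dots> \<le> (\<Sum>j<n. C / (real n * ?r)) + (4 * C / \<epsilon>\<^sup>2) / ?r"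
      by (intro add_mono sum_mono PD PB)
    also have "\<dots> = (C + 4 * C / \<epsilon>\<^sup>2) / ?r"
      using n by (simp add: add_divide_distrib)
    also have "\<dots> \<le> (C + 4 * C / \<epsilon>\<^sup>2 + 2 * C / \<epsilon>) / ?r"
      using C \<epsilon> r by (intro divide_right_mono) auto
    finally show ?thesis .
  qed
qed

lemma AE_sum_squares_average:
  "AE \<omega> in M. (\<lambda>n. (\<Sum>j<n. (X j \<omega>)\<^sup>2) / real n) \<longlonglongrightarrow> 1"
proof -
  let ?R = "\<lambda>n \<omega>. (\<Sum>j<n. (X j \<omega>)\<^sup>2) / real n"
  have "AE \<omega> in M. \<forall>\<^sub>F k in sequentially. \<bar>?R (k ^ 4) \<omega> - 1\<bar> \<le> 1 / real (Suc i)" for i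
  proof -
    let ?\<epsilon> = "1 / real (Suc i)"
    let ?K = "C + 4 * C / ?\<epsilon>\<^sup>2 + 2 * C / ?\<epsilon>"
    let ?A = "\<lambda>k. {\<omega> \<in> space M. ?\<epsilon> < \<bar>?R (k ^ 4) \<omega> - 1\<bar>}"
    have "prob (?A k) \<le> ?K * inverse (real k ^ 2)" if "1 \<le> k" for k
    proof -
      have "sqrt (real (k ^ 4)) = real k ^ 2"
        by (rule real_sqrt_unique) (simp_all flip: power_mult)
      then show ?thesis
        using sum_squares_deviation[of "k ^ 4" ?\<epsilon>] that by (simp add: divide_inverse)
    qed
    then have "summable (\<lambda>k. prob (?A k))"
      by (intro summable_comparison_test'[OF summable_mult[OF inverse_power_summable[of 2]], of 1 _ ?K])
        auto
    then have "AE \<omega> in M. \<forall>\<^sub>F k in sequentially. \<omega> \<in> space M - ?A k"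
      by (intro borel_cantelli_AE1) (auto simp: emeasure_eq_measure)
    then show ?thesis
      by eventually_elim (auto elim: eventually_mono)
  qed
  then have "AE \<omega> in M. \<forall>i. \<forall>\<^sub>F k in sequentially. \<bar>?R (k ^ 4) \<omega> - 1\<bar> \<le> 1 / real (Suc i)"
    by (simp add: AE_all_countable)
  then show ?thesis
  proof eventually_elim
    case (elim \<omega>)
    have "(\<lambda>k. ?R (k ^ 4) \<omega>) \<longlonglongrightarrow> 1"
    proof (rule tendstoI)
      fix e :: real assume "0 < e"
      then obtain i where i: "1 / real (Suc i) < e"
        using nat_approx_posE by auto
      from elim[rule_format, of i] show "\<forall>\<^sub>F k in sequentially. dist (?R (k ^ 4) \<omega>) 1 < e"
        by eventually_elim (use i in \<open>simp add: dist_real_def\<close>)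
    qed
    then show ?case
      by (intro monotone_average_limit monoI sum_mono2) auto
  qed
qed

end

end

section \<open>From empirical distribution functions to uniform convergence\<close>

text \<open>
  Polya's theorem.  The quantiles \<open>q i\<close> of \<open>G\<close> at the levels \<open>i / m\<close> divide the line into \<open>m\<close> pieces;
  once \<open>F n\<close> is close to \<open>G\<close> at these finitely many points, monotonicity controls it everywhere.
\<close>

lemma pointwise_imp_uniform_convergence_cdf:
  fixes F :: "nat \<Rightarrow> real \<Rightarrow> real" and G :: "real \<Rightarrow> real"
  assumes F_mono: "\<And>n. mono (F n)" and F_bounds: "\<And>n x. 0 \<le> F n x" "\<And>n x. F n x \<le> 1"
    and G_mono: "mono G" and G_cont: "\<And>x. isCont G x"
    and G_lim: "(G \<longlongrightarrow> 0) at_bot" "(G \<longlongrightarrow> 1) at_top"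
    and lim: "\<And>x. (\<lambda>n. F n x) \<longlonglongrightarrow> G x"
    and \<epsilon>: "0 < \<epsilon>"
  shows "\<forall>\<^sub>F n in sequentially. \<forall>x. \<bar>F n x - G x\<bar> \<le> \<epsilon>"
proof -
  obtain m :: nat where m: "3 / \<epsilon> < real m" using reals_Archimedean2 by blast
  with \<epsilon> have m0: "0 < m" by (metis divide_pos_pos gr0I not_less_iff_gr_or_eq of_nat_0 zero_less_numeral)
  have m\<epsilon>: "3 / real m \<le> \<epsilon>" using m m0 \<epsilon> by (simp add: field_simps)
  have quantile: "\<exists>q. G q = c" if c: "0 < c" "c < 1" for c
  proof -
    obtain a where a: "G a < c"
      using eventually_happens[OF order_tendstoD(2)[OF G_lim(1) c(1)]] by auto
    obtain b where b: "c < G b"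
      using eventually_happens[OF order_tendstoD(1)[OF G_lim(2) c(2)]] by auto
    have "a \<le> b"
      using a b monoD[OF G_mono, of b a] by linarith
    then show ?thesis
      using IVT'[of G a c b] a b G_cont by (auto simp: continuous_at_imp_continuous_on)
  qed
  have "\<exists>q. 0 < i \<longrightarrow> i < m \<longrightarrow> G q = real i / real m" for i
    using quantile[of "real i / real m"] by (cases "0 < i \<and> i < m") auto
  then obtain q where q: "\<And>i. 0 < i \<Longrightarrow> i < m \<Longrightarrow> G (q i) = real i / real m"
    by metis
  have "\<forall>\<^sub>F n in sequentially. \<forall>i\<in>{..<m}. \<bar>F n (q i) - G (q i)\<bar> < 1 / real m"
  proof (rule eventually_ball_finite)
    show "\<forall>i\<in>{..<m}. \<forall>\<^sub>F n in sequentially. \<bar>F n (q i) - G (q i)\<bar> < 1 / real m"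
      using tendstoD[OF lim] m0 by (auto simp: dist_real_def)
  qed simp
  then show ?thesis
  proof eventually_elim
    case (elim n)
    show ?case
    proof
      fix x
      have G01: "0 \<le> G x" "G x \<le> 1"
        using tendsto_upperbound[OF lim, of x 1] tendsto_lowerbound[OF lim, of 0 x] F_bounds by auto
      define i where "i = nat \<lfloor>real m * G x\<rfloor>"
      have i: "real i \<le> real m * G x" "real m * G x < real i + 1"
        using G01 by (simp_all add: i_def)
      have "real m * G x \<le> real m" using G01 by (simp add: mult_left_le)
      with i have im: "i \<le> m" by linarith
      have iG: "real i / real m \<le> G x" "G x < (real i + 1) / real m"
        using i m0 by (simp_all add: field_simps)
      have split: "(real i + 1) / real m = real i / real m + 1 / real m"
        "3 / real m = 3 * (1 / real m)" by (simp_all add: add_divide_distrib)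
      \<comment> \<open>As \<open>G\<close> need not be strictly monotone, each of the two estimates skips to a quantile at a level
        that differs from \<open>G x\<close>.\<close>
      have "F n x \<le> G x + 2 / real m"
      proof (cases "i + 1 < m")
        case True
        then have Gq: "G (q (i + 1)) = (real i + 1) / real m" using q[of "i + 1"] by simp
        then have "x \<le> q (i + 1)"
          using Gq iG(2) monoD[OF G_mono, of "q (i + 1)" x] by linarith
        then have "F n x \<le> F n (q (i + 1))" by (rule monoD[OF F_mono])
        then show ?thesis
          using elim[rule_format, of "i + 1"] True Gq iG(1) split by (simp add: abs_less_iff)
      next
        case False
        then have "1 \<le> (real i + 1) / real m" using m0 by simp
        then show ?thesis using F_bounds(2)[of n x] iG split by simp
      qed
      moreover have "G x - 3 / real m \<le> F n x"
      proof (cases "2 \<le> i")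
        case True
        then have Gq: "G (q (i - 1)) = real i / real m - 1 / real m"
          using q[of "i - 1"] im by (simp add: of_nat_diff diff_divide_distrib)
        then have "q (i - 1) \<le> x"
        proof -
          have "0 < 1 / real m" using m0 by simp
          then show ?thesis
            using Gq iG(1) monoD[OF G_mono, of x "q (i - 1)"] by linarith
        qed
        then have "F n (q (i - 1)) \<le> F n x" by (rule monoD[OF F_mono])
        moreover have "\<bar>F n (q (i - 1)) - G (q (i - 1))\<bar> < 1 / real m"
          using elim True im by auto
        ultimately show ?thesis
          using Gq iG(2) split by linarith
      next
        case False
        then have "real i + 1 \<le> 3" by simp
        then have "(real i + 1) / real m \<le> 3 / real m" by (rule divide_right_mono) simp
        with F_bounds(1)[of n x] iG(2) show ?thesis by linarith
      qed
      moreover have "2 / real m \<le> 3 / real m" by (rule divide_right_mono) simp_all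
      ultimately show "\<bar>F n x - G x\<bar> \<le> \<epsilon>" using m\<epsilon> by linarith
    qed
  qed
qed

text \<open>
  The rescaling factors are random in the application.  Restricting the arguments to the rationals
  leaves only countably many exceptional null sets.
\<close>

lemma convergence_undo_rescaling:
  fixes F :: "nat \<Rightarrow> real \<Rightarrow> real" and G :: "real \<Rightarrow> real"
  assumes F_mono: "\<And>n. mono (F n)" and G_cont: "isCont G x" and s: "s \<longlonglongrightarrow> 1"
    and lim: "\<And>r::rat. (\<lambda>n. F n (of_rat r * s n)) \<longlonglongrightarrow> G (of_rat r)"
  shows "(\<lambda>n. F n x) \<longlonglongrightarrow> G x"
proof (rule tendstoI)
  fix \<epsilon> :: real assume "0 < \<epsilon>"
  then obtain d where d: "0 < d" "\<And>t. \<bar>t - x\<bar> < d \<Longrightarrow> \<bar>G t - G x\<bar> < \<epsilon> / 2"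
    using G_cont unfolding continuous_at_eps_delta dist_real_def by (metis half_gt_zero)
  obtain r r' :: rat where r: "x - d < of_rat r" "of_rat r < x" and r': "x < of_rat r'" "of_rat r' < x + d"
    using of_rat_dense[of "x - d" x] of_rat_dense[of x "x + d"] d(1) by auto
  have "(\<lambda>n. of_rat r * s n) \<longlonglongrightarrow> of_rat r * 1" "(\<lambda>n. of_rat r' * s n) \<longlonglongrightarrow> of_rat r' * 1"
    by (intro tendsto_intros s)+
  then have "\<forall>\<^sub>F n in sequentially. of_rat r * s n < x" "\<forall>\<^sub>F n in sequentially. x < of_rat r' * s n"
    using r r' by (auto dest: order_tendstoD)
  moreover have "\<forall>\<^sub>F n in sequentially. dist (F n (of_rat r * s n)) (G (of_rat r)) < \<epsilon> / 2"
    "\<forall>\<^sub>F n in sequentially. dist (F n (of_rat r' * s n)) (G (of_rat r')) < \<epsilon> / 2"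
    by (rule tendstoD[OF lim], use \<open>0 < \<epsilon>\<close> in simp)+
  ultimately show "\<forall>\<^sub>F n in sequentially. dist (F n x) (G x) < \<epsilon>"
  proof eventually_elim
    case (elim n)
    have "F n (of_rat r * s n) \<le> F n x" "F n x \<le> F n (of_rat r' * s n)"
      using elim by (auto intro: monoD[OF F_mono])
    moreover have "\<bar>G (of_rat r) - G x\<bar> < \<epsilon> / 2" "\<bar>G (of_rat r') - G x\<bar> < \<epsilon> / 2"
      using r r' by (intro d(2); simp)+
    ultimately show ?case
      using elim(3,4) unfolding dist_real_def by linarith
  qed
qed

lemma (in prob_space) distr_pair_independent_of_sequence:
  assumes U [measurable]: "U \<in> measurable M N" and X [measurable]: "\<And>j. X j \<in> borel_measurable M"
    and indep: "independent_of_sequence M N U X"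
  shows "distr M (N \<Otimes>\<^sub>M (\<Pi>\<^sub>M j\<in>UNIV. borel)) (\<lambda>\<omega>. (U \<omega>, \<lambda>j. X j \<omega>))
    = distr M N U \<Otimes>\<^sub>M distr M (\<Pi>\<^sub>M j\<in>UNIV. borel) (\<lambda>\<omega> j. X j \<omega>)"
proof (rule pair_measure_eqI[symmetric])
  let ?P = "\<Pi>\<^sub>M j\<in>(UNIV :: nat set). (borel :: real measure)"
  let ?X = "\<lambda>\<omega> j. X j \<omega>"
  have X' [measurable]: "?X \<in> measurable M ?P"
    by (intro measurable_PiM_single') (auto simp: space_PiM)
  interpret N: prob_space "distr M N U" by (rule prob_space_distr) measurable
  interpret P: prob_space "distr M ?P ?X" by (rule prob_space_distr) measurable
  show "sigma_finite_measure (distr M N U)" "sigma_finite_measure (distr M ?P ?X)" ..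
  fix A B assume "A \<in> sets (distr M N U)" "B \<in> sets (distr M ?P ?X)"
  then have A [measurable]: "A \<in> sets N" and B [measurable]: "B \<in> sets ?P" by auto
  let ?A = "U -` A \<inter> space M" and ?B = "?X -` B \<inter> space M"
  have "prob (?A \<inter> ?B) = prob ?A * prob ?B"
    using indep unfolding independent_of_sequence_def
    by (rule indep_setD) (auto intro: in_vimage_algebra)
  then have "emeasure M (?A \<inter> ?B) = emeasure M ?A * emeasure M ?B"
    by (simp add: emeasure_eq_measure ennreal_mult)
  moreover have "(\<lambda>\<omega>. (U \<omega>, ?X \<omega>)) -` (A \<times> B) \<inter> space M = ?A \<inter> ?B" by auto
  ultimately show "emeasure (distr M N U) A * emeasure (distr M ?P ?X) B
      = emeasure (distr M (N \<Otimes>\<^sub>M ?P) (\<lambda>\<omega>. (U \<omega>, ?X \<omega>))) (A \<times> B)"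
    by (simp add: emeasure_distr)
qed simp

lemma mat_apply_restrict [simp]: "mat_apply n A (restrict x {..<n}) = mat_apply n A x"
  by (auto simp: mat_apply_def intro!: restrict_ext sum.cong)

lemma sqnorm_restrict [simp]: "sqnorm n (restrict x {..<n}) = sqnorm n x"
  by (simp add: sqnorm_def)

text \<open>
  Conditionally on \<open>X\<close> this is \<open>haar_image_eq_gaussian\<close> for the indicator of \<open>D\<close>, a cone: the
  threshold \<open>y \<bar>x\<bar> / \<surd>n\<close> scales with the vector.
\<close>

lemma (in prob_space) prob_ecdf_deviation_le_gaussian:
  fixes y \<epsilon> :: real
  assumes U: "uniform_on_orthogonal_group n M U"
    and X [measurable]: "\<And>j. X j \<in> borel_measurable M"
    and indep: "independent_of_sequence M (borel_orthogonal_group n) U X"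
  defines "D \<equiv> {x. \<epsilon> < \<bar>ecdf n x (y * sqrt (sqnorm n x / real n)) - \<Phi> y\<bar>}"
  defines "E \<equiv> {\<omega> \<in> space M. sqnorm n (\<lambda>j. X j \<omega>) \<noteq> 0 \<and> mat_apply n (U \<omega>) (\<lambda>j. X j \<omega>) \<in> D}"
  shows "E \<in> events" and "prob E \<le> measure (gaussian n) {x \<in> space (gaussian n). x \<in> D}"
proof -
  let ?O = "borel_orthogonal_group n" and ?N = "PiM {..<n} (\<lambda>_. borel :: real measure)"
  let ?P = "\<Pi>\<^sub>M j\<in>(UNIV :: nat set). (borel :: real measure)"
  let ?X = "\<lambda>\<omega> j. X j \<omega>"
  interpret G: prob_space "gaussian n" by (rule prob_space_gaussian)
  define f :: "(nat \<Rightarrow> real) \<Rightarrow> ennreal" where "f x = indicator D x" for x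
  have pD [measurable]: "Measurable.pred ?N (\<lambda>x. x \<in> D)"
    unfolding D_def mem_Collect_eq by measurable
  have f [measurable]: "f \<in> borel_measurable ?N"
    unfolding f_def by measurable
  have scale: "scale_invariant n f"
    unfolding scale_invariant_def
  proof (intro allI impI)
    fix c :: real and x :: "nat \<Rightarrow> real" assume c: "0 < c"
    have root: "sqrt (sqnorm n (\<lambda>i\<in>{..<n}. c * x i) / real n) = c * sqrt (sqnorm n x / real n)"
      unfolding sqnorm_scale times_divide_eq_right[symmetric] real_sqrt_mult using c by simp
    have "ecdf n (\<lambda>i\<in>{..<n}. c * x i) (y * sqrt (sqnorm n (\<lambda>i\<in>{..<n}. c * x i) / real n))
        = ecdf n x (y * sqrt (sqnorm n x / real n))"
      unfolding root mult.left_commute[of y c] by (rule ecdf_scale[OF c])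
    then show "f (\<lambda>i\<in>{..<n}. c * x i) = f x"
      by (simp only: f_def D_def indicator_def mem_Collect_eq)
  qed
  have Um [measurable]: "U \<in> measurable M ?O" and haar: "normalized_haar_measure n (distr M ?O U)"
    using U by (auto simp: uniform_on_orthogonal_group_def)
  have X' [measurable]: "?X \<in> measurable M ?P"
    by (intro measurable_PiM_single') (auto simp: space_PiM)
  have res: "(\<lambda>p. (fst p, restrict (snd p) {..<n})) \<in> measurable (?O \<Otimes>\<^sub>M ?P) (?O \<Otimes>\<^sub>M ?N)"
    by (intro measurable_Pair measurable_compose[OF measurable_snd measurable_restrict_subset]) auto
  have app [measurable]: "(\<lambda>p. mat_apply n (fst p) (snd p)) \<in> measurable (?O \<Otimes>\<^sub>M ?P) ?N"
    using measurable_compose[OF res measurable_mat_apply_pair] by (simp add: case_prod_beta)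
  have sq [measurable]: "sqnorm n \<in> borel_measurable ?P"
    unfolding sqnorm_def by measurable
  define h where "h p = indicator {z. sqnorm n z \<noteq> 0} (snd p) * f (mat_apply n (fst p) (snd p))"
    for p :: "real mat \<times> (nat \<Rightarrow> real)"
  have h [measurable]: "h \<in> borel_measurable (?O \<Otimes>\<^sub>M ?P)"
    unfolding h_def by measurable
  have E_eq: "indicator E \<omega> = h (U \<omega>, ?X \<omega>)" if "\<omega> \<in> space M" for \<omega>
    using that by (simp add: E_def h_def f_def indicator_def)
  have "(\<lambda>\<omega>. mat_apply n (U \<omega>) (?X \<omega>)) \<in> measurable M ?N"
    using measurable_compose[OF _ app, of "\<lambda>\<omega>. (U \<omega>, ?X \<omega>)" M] by simp
  then have "Measurable.pred M (\<lambda>\<omega>. mat_apply n (U \<omega>) (?X \<omega>) \<in> D)"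
    by (rule measurable_compose[OF _ pD])
  then show E: "E \<in> events"
    unfolding E_def by measurable
  interpret H: prob_space "distr M ?O U" by (rule prob_space_distr) measurable
  interpret Q: prob_space "distr M ?P ?X" by (rule prob_space_distr) measurable
  interpret pair_sigma_finite "distr M ?O U" "distr M ?P ?X"
    by (intro pair_sigma_finite.intro H.sigma_finite_measure_axioms Q.sigma_finite_measure_axioms)
  have "emeasure M E = (\<integral>\<^sup>+\<omega>. indicator E \<omega> \<partial>M)"
    using E by simp
  also have "\<dots> = (\<integral>\<^sup>+\<omega>. h (U \<omega>, ?X \<omega>) \<partial>M)"
    by (intro nn_integral_cong E_eq)
  also have "\<dots> = integral\<^sup>N (distr M (?O \<Otimes>\<^sub>M ?P) (\<lambda>\<omega>. (U \<omega>, ?X \<omega>))) h"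
    using h by (intro nn_integral_distr[symmetric]) simp_all
  also have "\<dots> = integral\<^sup>N (distr M ?O U \<Otimes>\<^sub>M distr M ?P ?X) h"
    by (simp only: distr_pair_independent_of_sequence[OF Um X indep])
  also have "\<dots> = (\<integral>\<^sup>+z. \<integral>\<^sup>+A. h (A, z) \<partial>distr M ?O U \<partial>distr M ?P ?X)"
    using h by (intro nn_integral_snd[symmetric])
      (simp add: measurable_cong_sets[OF sets_pair_measure_cong[OF sets_distr sets_distr] refl])
  also have "\<dots> \<le> (\<integral>\<^sup>+z. integral\<^sup>N (gaussian n) f \<partial>distr M ?P ?X)"
  proof (intro nn_integral_mono)
    fix z :: "nat \<Rightarrow> real"
    show "(\<integral>\<^sup>+A. h (A, z) \<partial>distr M ?O U) \<le> integral\<^sup>N (gaussian n) f"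
    proof (cases "sqnorm n z = 0")
      case True
      then show ?thesis by (simp add: h_def)
    next
      case False
      then show ?thesis
        using haar_image_eq_gaussian[OF haar f scale, of "restrict z {..<n}"] by (simp add: h_def)
    qed
  qed
  also have "\<dots> = integral\<^sup>N (gaussian n) f"
    by (simp add: Q.emeasure_space_1[simplified])
  also have "\<dots> = (\<integral>\<^sup>+x. indicator {x \<in> space (gaussian n). x \<in> D} x \<partial>gaussian n)"
    by (intro nn_integral_cong) (simp add: f_def indicator_def)
  also have "\<dots> = emeasure (gaussian n) {x \<in> space (gaussian n). x \<in> D}"
    by (rule nn_integral_indicator) measurable
  finally show "prob E \<le> measure (gaussian n) {x \<in> space (gaussian n). x \<in> D}"
    by (simp add: emeasure_eq_measure G.emeasure_eq_measure)
qed

theorem corollary1p7: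
  fixes M :: "'a measure"
    and X :: "nat \<Rightarrow> 'a \<Rightarrow> real"
    and U :: "nat \<Rightarrow> 'a \<Rightarrow> real mat"
    and S :: "nat \<Rightarrow> nat \<Rightarrow> 'a \<Rightarrow> real"
  assumes "prob_space M"
    and "prob_space.indep_vars M (\<lambda>_. borel) X UNIV"
    and "\<And>j. (\<integral>\<omega>. X j \<omega> \<partial>M) = 0"
    and "\<And>j. (\<integral>\<omega>. (X j \<omega>)\<^sup>2 \<partial>M) = 1"
    and "(SUP j. \<integral>\<^sup>+\<omega>. ennreal (\<bar>X j \<omega>\<bar> ^ 3) \<partial>M) < \<infinity>"
    and "\<And>n. n \<ge> 1 \<Longrightarrow> uniform_on_orthogonal_group n M (U n)"
    and "\<And>n. n \<ge> 1 \<Longrightarrow> independent_of_sequence M (borel_orthogonal_group n) (U n) X"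
    and "\<And>n k \<omega>. n \<ge> 1 \<Longrightarrow> k < n \<Longrightarrow> S n k \<omega> = (\<Sum>j<n. U n \<omega> $$ (k, j) * X j \<omega>)"
  shows "AE \<omega> in M.
    (\<lambda>n. SUP x::real.
      \<bar>(1 / real n) * (\<Sum>k<n. indicator {\<omega>'. S n k \<omega>' \<le> x} \<omega>)
        - (1 / sqrt (2 * pi)) * (LINT u:{..x}|lborel. exp (- (u\<^sup>2 / 2)))\<bar>)
    \<longlonglongrightarrow> 0"
proof -
  interpret prob_space M by fact
  interpret \<Phi>: real_distribution std_normal_distribution by (rule real_dist_normal_dist)
  note indep = assms(2) and second = assms(4) and third_SUP = assms(5)
  have X [measurable]: "X j \<in> borel_measurable M" for j
    using indep unfolding indep_vars_def by blast
  define C where "C = enn2real (SUP j. \<integral>\<^sup>+\<omega>. ennreal (\<bar>X j \<omega>\<bar> ^ 3) \<partial>M)"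
  have third_le: "(\<integral>\<^sup>+\<omega>. ennreal (\<bar>X j \<omega>\<bar> ^ 3) \<partial>M) \<le> (SUP j. \<integral>\<^sup>+\<omega>. ennreal (\<bar>X j \<omega>\<bar> ^ 3) \<partial>M)" for j
    by (rule SUP_upper) simp
  have third_int: "integrable M (\<lambda>\<omega>. \<bar>X j \<omega>\<bar> ^ 3)" for j
    using le_less_trans[OF third_le third_SUP] by (intro integrableI_bounded) auto
  have third: "expectation (\<lambda>\<omega>. \<bar>X j \<omega>\<bar> ^ 3) \<le> C" for j
    unfolding C_def using third_le[of j] third_SUP
    by (subst integral_eq_nn_integral) (auto intro!: enn2real_mono)
  let ?x = "\<lambda>\<omega> j. X j \<omega>"
  define V where "V n \<omega> = mat_apply n (U n \<omega>) (?x \<omega>)" for n \<omega>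
  define \<rho> where "\<rho> n \<omega> = sqrt (sqnorm n (?x \<omega>) / real n)" for n \<omega>
  have "AE \<omega> in M. (\<lambda>n. sqnorm n (?x \<omega>) / real n) \<longlonglongrightarrow> 1"
    using AE_sum_squares_average[OF indep second third_int third] by (simp add: sqnorm_def)
  moreover have "AE \<omega> in M. \<forall>(r::rat) (i::nat). \<forall>\<^sub>F n in sequentially. sqnorm n (?x \<omega>) \<noteq> 0 \<longrightarrow>
      \<bar>ecdf n (V n \<omega>) (of_rat r * \<rho> n \<omega>) - \<Phi> (of_rat r)\<bar> \<le> 1 / real (Suc i)"
  proof -
    have "AE \<omega> in M. \<forall>\<^sub>F n in sequentially. sqnorm n (?x \<omega>) \<noteq> 0 \<longrightarrow>
      \<bar>ecdf n (V n \<omega>) (y * \<rho> n \<omega>) - \<Phi> y\<bar> \<le> \<epsilon>" if \<epsilon>: "0 < \<epsilon>" for y \<epsilon> :: real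
    proof -
      define D where "D n = {x. \<epsilon> < \<bar>ecdf n x (y * sqrt (sqnorm n x / real n)) - \<Phi> y\<bar>}" for n
      define E where "E n = {\<omega> \<in> space M. sqnorm n (?x \<omega>) \<noteq> 0 \<and> V n \<omega> \<in> D n}" for n
      obtain b where b: "summable b" "\<And>n. 0 < n \<Longrightarrow> measure (gaussian n)
          {x \<in> space (gaussian n). \<epsilon> < \<bar>ecdf n x (y * sqrt (sqnorm n x / real n)) - \<Phi> y\<bar>} \<le> b n"
        by (rule gaussian_normalized_ecdf_summable_tail[OF \<epsilon>, of y]) blast
      \<comment> \<open>The assumptions on the matrices start with \<open>n = 1\<close>, hence the shift of the index.\<close>
      have E: "E (Suc n) \<in> events" "prob (E (Suc n)) \<le> b (Suc n)" for n
      proof -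
        have n1: "1 \<le> Suc n" by simp
        note dev = prob_ecdf_deviation_le_gaussian[OF assms(6)[OF n1] X assms(7)[OF n1],
          where y = y and \<epsilon> = \<epsilon>, folded V_def D_def]
        show "E (Suc n) \<in> events"
          unfolding E_def by (rule dev(1))
        have "prob (E (Suc n)) \<le> measure (gaussian (Suc n)) {x \<in> space (gaussian (Suc n)). x \<in> D (Suc n)}"
          unfolding E_def by (rule dev(2))
        also have "\<dots> \<le> b (Suc n)"
          using b(2)[of "Suc n"] by (simp only: D_def mem_Collect_eq zero_less_Suc)
        finally show "prob (E (Suc n)) \<le> b (Suc n)" .
      qed
      have "summable (\<lambda>n. prob (E (Suc n)))"
      proof (rule summable_comparison_test')
        show "summable (\<lambda>n. b (Suc n))"
          using b(1) by (subst summable_Suc_iff)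
        show "norm (prob (E (Suc n))) \<le> b (Suc n)" if "0 \<le> n" for n
          using E(2)[of n] by simp
      qed
      then have "AE \<omega> in M. \<forall>\<^sub>F n in sequentially. \<omega> \<in> space M - E (Suc n)"
        by (intro borel_cantelli_AE1 E(1)) (simp_all add: emeasure_eq_measure)
      then show ?thesis
      proof (rule AE_mp, intro AE_I2 impI)
        fix \<omega> assume \<omega>: "\<omega> \<in> space M" "\<forall>\<^sub>F n in sequentially. \<omega> \<in> space M - E (Suc n)"
        have U_orth: "U n \<omega> \<in> orthogonal_group n" if "1 \<le> n" for n
          using assms(6)[OF that] \<omega>(1)
          by (auto simp: uniform_on_orthogonal_group_def dest: measurable_space)
        have "\<forall>\<^sub>F n in sequentially. \<omega> \<notin> E n \<and> 1 \<le> n"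
        proof -
          have "\<forall>\<^sub>F n in sequentially. \<omega> \<notin> E (Suc n) \<and> 1 \<le> Suc n"
            using \<omega>(2) by eventually_elim simp
          then show ?thesis
            by (rule eventually_sequentially_Suc[THEN iffD1])
        qed
        then show "\<forall>\<^sub>F n in sequentially. sqnorm n (?x \<omega>) \<noteq> 0 \<longrightarrow>
            \<bar>ecdf n (V n \<omega>) (y * \<rho> n \<omega>) - \<Phi> y\<bar> \<le> \<epsilon>"
        proof eventually_elim
          case (elim n)
          then have "sqnorm n (V n \<omega>) = sqnorm n (?x \<omega>)"
            unfolding V_def by (intro sqnorm_mat_apply U_orth) simp
          with elim \<omega>(1) show ?case by (auto simp: E_def D_def \<rho>_def)
        qed
      qed
    qed
    then show ?thesis by (simp add: AE_all_countable)
  qed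
  ultimately show ?thesis
  proof eventually_elim
    case (elim \<omega>)
    have \<rho>: "(\<lambda>n. \<rho> n \<omega>) \<longlonglongrightarrow> 1"
      using tendsto_real_sqrt[OF elim(1)] by (simp add: \<rho>_def)
    have nz: "\<forall>\<^sub>F n in sequentially. sqnorm n (?x \<omega>) \<noteq> 0"
      using order_tendstoD(1)[OF elim(1), of 0] by (auto elim: eventually_mono)
    have rat_lim: "(\<lambda>n. ecdf n (V n \<omega>) (of_rat r * \<rho> n \<omega>)) \<longlonglongrightarrow> \<Phi> (of_rat r)" for r
    proof (rule tendstoI)
      fix e :: real assume "0 < e"
      then obtain i where i: "1 / real (Suc i) < e" using nat_approx_posE by auto
      from elim(2)[rule_format, of r i] nz
      show "\<forall>\<^sub>F n in sequentially. dist (ecdf n (V n \<omega>) (of_rat r * \<rho> n \<omega>)) (\<Phi> (of_rat r)) < e"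
        by eventually_elim (use i in \<open>auto simp: dist_real_def\<close>)
    qed
    have ecdf_mono': "mono (ecdf n (V n \<omega>))" for n
      by (intro monoI ecdf_mono)
    have lim: "(\<lambda>n. ecdf n (V n \<omega>) x) \<longlonglongrightarrow> \<Phi> x" for x
      by (rule convergence_undo_rescaling[OF ecdf_mono' isCont_std_normal_cdf \<rho> rat_lim])
    define d where "d n x = \<bar>(1 / real n) * (\<Sum>k<n. indicator {\<omega>'. S n k \<omega>' \<le> x} \<omega>)
        - (1 / sqrt (2 * pi)) * (LINT u:{..x}|lborel. exp (- (u\<^sup>2 / 2)))\<bar>" for n x
    have d: "d n x = \<bar>ecdf n (V n \<omega>) x - \<Phi> x\<bar>" for n x
    proof -
      have "indicator {\<omega>'. S n k \<omega>' \<le> x} \<omega> = (indicator {..x} (V n \<omega> k) :: real)" if "k < n" for k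
        using that assms(8)[of n k \<omega>] by (simp add: V_def mat_apply_def indicator_def)
      then show ?thesis
        unfolding d_def std_normal_cdf_eq[symmetric] by (simp add: ecdf_def)
    qed
    have "(\<lambda>n. SUP x. d n x) \<longlonglongrightarrow> 0"
    proof (rule tendstoI)
      fix e :: real assume e: "0 < e"
      have "\<forall>\<^sub>F n in sequentially. \<forall>x. \<bar>ecdf n (V n \<omega>) x - \<Phi> x\<bar> \<le> e / 2"
      proof (rule pointwise_imp_uniform_convergence_cdf)
        show "mono \<Phi>" by (intro monoI \<Phi>.cdf_nondecreasing)
      qed (use e in \<open>auto simp: ecdf_mono' ecdf_nonneg ecdf_le_1 isCont_std_normal_cdf lim
          \<Phi>.cdf_lim_at_bot \<Phi>.cdf_lim_at_top_prob\<close>)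
      then show "\<forall>\<^sub>F n in sequentially. dist (SUP x. d n x) 0 < e"
      proof eventually_elim
        case (elim n)
        have le: "d n x \<le> e / 2" for x using elim by (simp add: d)
        have "0 \<le> d n 0" by (simp add: d)
        also have "d n 0 \<le> (SUP x. d n x)"
          using le by (intro cSUP_upper bdd_aboveI2[of _ _ "e / 2"]) auto
        finally have "0 \<le> (SUP x. d n x)" .
        moreover have "(SUP x. d n x) \<le> e / 2"
          using le by (intro cSUP_least) auto
        ultimately show ?case using e by simp
      qed
    qed
    then show ?case by (simp only: d_def)
  qed
qed

end
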